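(* Fix a threshold $\alpha$, and let $\theta_0^{\mathrm{TPR}(\alpha)}:=\Pr(R>\alpha\mid Y=1)=\mathbb E[I(R>\alpha)Y]/\mathbb E[Y]$. Define $$\hat\theta_n:=\frac{\sum_{i=1}^nI(R_i>\alpha)Y_i}{\sum_{i=1}^nY_i},\quad \hat\theta^f_n:=\frac{\sum_{i=1}^nI(R_i>\alpha)f(X_i)}{\sum_{i=1}^nf(X_i)},\quad \hat\theta^f_{n+N}:=\frac{\sum_{i=1}^{n+N}I(R_i>\alpha)f(X_i)}{\sum_{i=1}^{n+N}f(X_i)}.$$ Then $\hat\theta_n$ and $\hat\theta_n^f$ are asymptotically linear with influence functions (evaluated at a single observation), respectively, $$\phi^{\mathrm{TPR}(\alpha)}(R_i,Y_i)=\frac{I(R_i>\alpha)Y_i}{\mathbb E[Y]}-\frac{\mathbb E[I(R>\alpha)Y]\,Y_i}{\mathbb E[Y]^2},$$ $$\phi^{\mathrm{TPR}(\alpha)}(R_i,f(X_i))=\frac{I(R_i>\alpha)f(X_i)}{\mathbb E[f(X)]}-\frac{\mathbb E[I(R>\alpha)f(X)]\,f(X_i)}{\mathbb E[f(X)]^2}.$$ Furthermore, let $\hat\theta^{\mathrm{PP}}:=\hat\theta_n+\hat\omega(\hat\theta^f_{n+N}-\hat\theta^f_n)$, and suppose that $n/N\to\lambda$ and $$\hat\omega\xrightarrow{p}\frac{\mathbb E[\phi^{\mathrm{TPR}(\alpha)}(R,Y)\,\phi^{\mathrm{TPR}(\alpha)}(R,f(X))]}{\mathbb E[\phi^{\mathrm{TPR}(\alpha)}(R,f(X))^2]}.$$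 Then $$\sqrt n\,\big(\hat\theta^{\mathrm{PP}}-\theta_0^{\mathrm{TPR}(\alpha)}\big)\xrightarrow{d}N\left(0,\ \mathbb E[\phi^{\mathrm{TPR}(\alpha)}(R,Y)^2]-\frac{\big(\mathbb E[\phi^{\mathrm{TPR}(\alpha)}(R,Y)\,\phi^{\mathrm{TPR}(\alpha)}(R,f(X))]\big)^2}{(1+\lambda)\,\mathbb E[\phi^{\mathrm{TPR}(\alpha)}(R,f(X))^2]}\right).$$
   Context: Setting: $Y\in\{0,1\}$ with $0<\Pr(Y=1)<1$; $R$ is a real-valued biomarker, which is one of the components of the covariate vector $X$; $f$ is a fixed deterministic function with $f(X)\ge0$, $\mathbb E[f(X)](1-\mathbb E[f(X)])\ne0$ and $\mathbb E[f(X)^2]<\infty$. The labeled data $(R_i,f(X_i),Y_i)_{i=1}^n$ are i.i.d. copies of $(R,f(X),Y)$; the unlabeled data $(R_i,f(X_i))_{i=n+1}^{n+N}$ are i.i.d. copies of $(R,f(X))$, independent of the labeled data. $n,N\to\infty$ with $0\le\lambda<\infty$, and $\mathbb E[\phi^{\mathrm{TPR}(\alpha)}(R,f(X))^2]>0$. An estimator $\hat\theta_n$ is asymptotically linear for $\theta$ with influence function $\phi$ if $\hat\theta_n-\theta=\frac1n\sum_{i=1}^n\phi(\text{observation } i)+o_p(n^{-1/2})$; $\hat\theta_n$ is centered at $\theta_0^{\mathrm{TPR}(\alpha)}$ and $\hat\theta^f_n$ at $\mathbb E[I(R>\alpha)f(X)]/\mathbb E[f(X)]$. The expression $\phi^{\mathrm{TPR}(\alpha)}(R,f(X))$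 is defined by its displayed formula (in which the expectations involve $f(X)$, not $Y$). *)

theory Defs
  imports "HOL-Probability.Probability"
begin

(* All asymptotic notions are indexed by k, with a possibly different sample space M k for
   each k. *)

definition conv_in_prob ::
  "(nat \<Rightarrow> 'b measure) \<Rightarrow> (nat \<Rightarrow> 'b \<Rightarrow> real) \<Rightarrow> real \<Rightarrow> bool" where
  "conv_in_prob M Z c \<longleftrightarrow>
     (\<forall>\<epsilon>>0. (\<lambda>k. \<P>(\<omega> in M k. \<epsilon> < \<bar>Z k \<omega> - c\<bar>)) \<longlonglongrightarrow> 0)"

definition small_o_prob ::
  "(nat \<Rightarrow> 'b measure) \<Rightarrow> (nat \<Rightarrow> 'b \<Rightarrow> real) \<Rightarrow> (nat \<Rightarrow> real) \<Rightarrow> bool" where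
  "small_o_prob M Z a \<longleftrightarrow> conv_in_prob M (\<lambda>k \<omega>. Z k \<omega> / a k) 0"

(* n k is the sample size and Ob k i, for 1 <= i <= n k, are the observations. *)

definition asymptotically_linear ::
  "(nat \<Rightarrow> 'b measure) \<Rightarrow> (nat \<Rightarrow> nat) \<Rightarrow> (nat \<Rightarrow> nat \<Rightarrow> 'b \<Rightarrow> 'o)
    \<Rightarrow> (nat \<Rightarrow> 'b \<Rightarrow> real) \<Rightarrow> real \<Rightarrow> ('o \<Rightarrow> real) \<Rightarrow> bool" where
  "asymptotically_linear M n Ob \<theta>hat \<theta> \<phi> \<longleftrightarrow>
     small_o_prob M
       (\<lambda>k \<omega>. \<theta>hat k \<omega> - \<theta> - 1 / real (n k) * (\<Sum>i=1..n k. \<phi> (Ob k i \<omega>)))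
       (\<lambda>k. 1 / sqrt (real (n k)))"

definition iid_copies ::
  "'b measure \<Rightarrow> nat set \<Rightarrow> (nat \<Rightarrow> 'b \<Rightarrow> 'o::topological_space)
    \<Rightarrow> 'a measure \<Rightarrow> ('a \<Rightarrow> 'o) \<Rightarrow> bool" where
  "iid_copies M I Z P Z0 \<longleftrightarrow>
     prob_space.indep_vars M (\<lambda>_. borel) Z I \<and>
     (\<forall>i\<in>I. distr M borel (Z i) = distr P borel Z0)"

(* The library's indep_var requires both random variables to have the same value type. *)

definition independent_rvs ::
  "'b measure \<Rightarrow> 'c measure \<Rightarrow> ('b \<Rightarrow> 'c) \<Rightarrow> 'd measure \<Rightarrow> ('b \<Rightarrow> 'd) \<Rightarrow> bool" where
  "independent_rvs M A V B W \<longleftrightarrow>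
     V \<in> M \<rightarrow>\<^sub>M A \<and> W \<in> M \<rightarrow>\<^sub>M B \<and>
     prob_space.indep_set M {V -` a \<inter> space M | a. a \<in> sets A}
       {W -` b \<inter> space M | b. b \<in> sets B}"

(* Pushing forward the standard normal law, instead of giving a density, makes the case v = 0
   the point mass at m. *)

definition normal_law :: "real \<Rightarrow> real \<Rightarrow> real measure" where
  "normal_law m v = distr std_normal_distribution borel (\<lambda>z. m + sqrt v * z)"

lemma normal_law_pos:
  assumes "0 < v"
  shows "normal_law m v = density lborel (normal_density m (sqrt v))"
proof -
  interpret prob_space std_normal_distribution
    by (simp add: prob_space_normal_density)
  have "distributed std_normal_distribution lborel (\<lambda>z. z) std_normal_density"
    by (simp add: distributed_def distr_id2)
  from normal_density_affine[OF this, of "sqrt v" m]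
  have "distributed std_normal_distribution lborel (\<lambda>z. m + sqrt v * z) (normal_density m (sqrt v))"
    using assms by simp
  then show ?thesis
    by (simp add: normal_law_def distributed_def cong: distr_cong)
qed

lemma normal_law_zero: "normal_law m 0 = return borel m"
proof -
  interpret prob_space std_normal_distribution
    by (simp add: prob_space_normal_density)
  show ?thesis
    by (simp add: normal_law_def distr_const)
qed

(* W is the outcome: either Y or its prediction f(X). *)

definition tpr_estimator :: "real \<Rightarrow> (nat \<Rightarrow> real) \<Rightarrow> (nat \<Rightarrow> real) \<Rightarrow> nat \<Rightarrow> real" where
  "tpr_estimator \<alpha> R W m =
     (\<Sum>i=1..m. of_bool (\<alpha> < R i) * W i) / (\<Sum>i=1..m. W i)"

definition tpr_influence ::
  "'a measure \<Rightarrow> real \<Rightarrow> ('a \<Rightarrow> real) \<Rightarrow> ('a \<Rightarrow> real) \<Rightarrow> real \<times> real \<Rightarrow> real" where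
  "tpr_influence P \<alpha> R W = (\<lambda>(r, w).
     of_bool (\<alpha> < r) * w / (LINT \<omega>|P. W \<omega>)
     - (LINT \<omega>|P. of_bool (\<alpha> < R \<omega>) * W \<omega>) * w / (LINT \<omega>|P. W \<omega>)\<^sup>2)"

end

theory Submission
  imports Defs
begin

text \<open>
  A ratio estimator \<open>A / B\<close> of \<open>a / b\<close> satisfies
  \<open>A/B - a/b = L + L (b - B)/B\<close> with \<open>L = A/b - a B/b\<^sup>2\<close> the mean of the influence function, and
  Chebyshev's inequality makes \<open>\<surd>n L\<close> bounded in probability and \<open>B \<rightarrow> b\<close>.
  For the prediction-powered estimator, the three expansions combine, up to a term that vanishes in
  probability, into a normalised sum of \<open>\<phi>Y - w \<phi>f / (1 + \<lambda>)\<close> over the labeled data plus an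
  independent normalised sum of \<open>w \<surd>\<lambda> \<phi>f / (1 + \<lambda>)\<close> over the unlabeled data.  The characteristic
  functions of the two sums converge to Gaussian ones, so Levy's continuity theorem gives the limit,
  including the degenerate case of variance zero.
\<close>

subsection \<open>Convergence and boundedness in probability\<close>

lemma (in prob_space) prob_le_add:
  assumes "{x \<in> space M. A x} \<in> events" "{x \<in> space M. B x} \<in> events"
    and "\<And>x. x \<in> space M \<Longrightarrow> C x \<Longrightarrow> A x \<or> B x"
  shows "prob {x \<in> space M. C x} \<le> prob {x \<in> space M. A x} + prob {x \<in> space M. B x}"
proof -
  have "prob {x \<in> space M. C x} \<le> prob ({x \<in> space M. A x} \<union> {x \<in> space M. B x})"
    using assms by (intro finite_measure_mono) auto
  also have "\<dots> \<le> prob {x \<in> space M. A x} + prob {x \<in> space M. B x}"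
    using assms by (intro measure_Un_le) auto
  finally show ?thesis .
qed

definition bounded_in_prob :: "(nat \<Rightarrow> 'b measure) \<Rightarrow> (nat \<Rightarrow> 'b \<Rightarrow> real) \<Rightarrow> bool" where
  "bounded_in_prob M Z \<longleftrightarrow>
     (\<forall>\<epsilon>>0. \<exists>K>0. eventually (\<lambda>k. \<P>(\<omega> in M k. K < \<bar>Z k \<omega>\<bar>) < \<epsilon>) sequentially)"

lemma conv_in_prob_cong:
  assumes "eventually (\<lambda>k. \<forall>\<omega>\<in>space (M k). Z k \<omega> = W k \<omega>) sequentially"
  shows "conv_in_prob M Z c \<longleftrightarrow> conv_in_prob M W c"
proof -
  have "eventually (\<lambda>k. \<P>(\<omega> in M k. \<epsilon> < \<bar>Z k \<omega> - c\<bar>) = \<P>(\<omega> in M k. \<epsilon> < \<bar>W k \<omega> - c\<bar>)) sequentially"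
    for \<epsilon>
    using assms by eventually_elim (auto intro!: arg_cong2[where f=measure])
  then show ?thesis
    unfolding conv_in_prob_def by (intro all_cong1 imp_cong refl tendsto_cong) auto
qed

lemma conv_in_prob_shift: "conv_in_prob M Z c \<longleftrightarrow> conv_in_prob M (\<lambda>k \<omega>. Z k \<omega> - c) 0"
  by (simp add: conv_in_prob_def)

locale prob_space_sequence =
  fixes M :: "nat \<Rightarrow> 'b measure"
  assumes prob_space_M: "\<And>k. prob_space (M k)"
begin

sublocale prob_space "M k" for k
  by (rule prob_space_M)

lemma conv_in_probI_union:
  assumes [measurable]: "\<And>k. Z k \<in> borel_measurable (M k)" "\<And>k. W k \<in> borel_measurable (M k)"
    and Z: "conv_in_prob M Z a" and W: "conv_in_prob M W b"
    and le: "\<And>\<epsilon>. 0 < \<epsilon> \<Longrightarrow> \<exists>\<delta>>0. \<exists>\<eta>>0. \<forall>k. \<forall>\<omega>\<in>space (M k).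
               \<bar>Z k \<omega> - a\<bar> \<le> \<delta> \<longrightarrow> \<bar>W k \<omega> - b\<bar> \<le> \<eta> \<longrightarrow> \<bar>U k \<omega> - c\<bar> \<le> \<epsilon>"
  shows "conv_in_prob M U c"
  unfolding conv_in_prob_def
proof safe
  fix \<epsilon> :: real assume "0 < \<epsilon>"
  from le[OF this] obtain \<delta> \<eta> where pos: "0 < \<delta>" "0 < \<eta>"
    and d: "\<And>k \<omega>. \<omega> \<in> space (M k) \<Longrightarrow> \<bar>Z k \<omega> - a\<bar> \<le> \<delta> \<Longrightarrow> \<bar>W k \<omega> - b\<bar> \<le> \<eta> \<Longrightarrow> \<bar>U k \<omega> - c\<bar> \<le> \<epsilon>"
    by blast
  have le_add: "\<P>(\<omega> in M k. \<epsilon> < \<bar>U k \<omega> - c\<bar>)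
      \<le> \<P>(\<omega> in M k. \<delta> < \<bar>Z k \<omega> - a\<bar>) + \<P>(\<omega> in M k. \<eta> < \<bar>W k \<omega> - b\<bar>)" for k
  proof (rule prob_le_add)
    fix \<omega> assume "\<omega> \<in> space (M k)" "\<epsilon> < \<bar>U k \<omega> - c\<bar>"
    then show "\<delta> < \<bar>Z k \<omega> - a\<bar> \<or> \<eta> < \<bar>W k \<omega> - b\<bar>"
      using d[of \<omega> k] by fastforce
  qed measurable
  have lim: "(\<lambda>k. \<P>(\<omega> in M k. \<delta> < \<bar>Z k \<omega> - a\<bar>) + \<P>(\<omega> in M k. \<eta> < \<bar>W k \<omega> - b\<bar>)) \<longlonglongrightarrow> 0"
    using Z W pos unfolding conv_in_prob_def by (intro tendsto_add_zero) auto
  show "(\<lambda>k. \<P>(\<omega> in M k. \<epsilon> < \<bar>U k \<omega> - c\<bar>)) \<longlonglongrightarrow> 0"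
    by (intro tendsto_sandwich[OF _ _ tendsto_const lim] always_eventually allI le_add measure_nonneg)
qed

lemma conv_in_prob_add:
  assumes "\<And>k. Z k \<in> borel_measurable (M k)" "\<And>k. W k \<in> borel_measurable (M k)"
    and "conv_in_prob M Z a" "conv_in_prob M W b"
  shows "conv_in_prob M (\<lambda>k \<omega>. Z k \<omega> + W k \<omega>) (a + b)"
proof (rule conv_in_probI_union[OF assms])
  fix \<epsilon> :: real assume "0 < \<epsilon>"
  then show "\<exists>\<delta>>0. \<exists>\<eta>>0. \<forall>k. \<forall>\<omega>\<in>space (M k).
      \<bar>Z k \<omega> - a\<bar> \<le> \<delta> \<longrightarrow> \<bar>W k \<omega> - b\<bar> \<le> \<eta> \<longrightarrow> \<bar>Z k \<omega> + W k \<omega> - (a + b)\<bar> \<le> \<epsilon>"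
    by (intro exI[of _ "\<epsilon> / 2"] conjI allI ballI impI) linarith+
qed

lemma conv_in_prob_mult_bounded:
  assumes [measurable]: "\<And>k. Z k \<in> borel_measurable (M k)" "\<And>k. W k \<in> borel_measurable (M k)"
    and Z: "conv_in_prob M Z 0" and W: "bounded_in_prob M W"
  shows "conv_in_prob M (\<lambda>k \<omega>. Z k \<omega> * W k \<omega>) 0"
  unfolding conv_in_prob_def
proof safe
  fix \<epsilon> :: real assume \<epsilon>: "0 < \<epsilon>"
  show "(\<lambda>k. \<P>(\<omega> in M k. \<epsilon> < \<bar>Z k \<omega> * W k \<omega> - 0\<bar>)) \<longlonglongrightarrow> 0"
  proof (rule LIMSEQ_I)
    fix r :: real assume "0 < r"
    then obtain K where K: "0 < K" and bd: "eventually (\<lambda>k. \<P>(\<omega> in M k. K < \<bar>W k \<omega>\<bar>) < r / 2) sequentially"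
      using W unfolding bounded_in_prob_def by (meson half_gt_zero)
    have "eventually (\<lambda>k. \<P>(\<omega> in M k. \<epsilon> / K < \<bar>Z k \<omega> - 0\<bar>) < r / 2) sequentially"
      using Z \<epsilon> K \<open>0 < r\<close> unfolding conv_in_prob_def
      by (intro order_tendstoD(2)[where y = 0]) auto
    with bd have "eventually (\<lambda>k. \<P>(\<omega> in M k. \<epsilon> < \<bar>Z k \<omega> * W k \<omega> - 0\<bar>) < r) sequentially"
    proof eventually_elim
      case (elim k)
      have "\<P>(\<omega> in M k. \<epsilon> < \<bar>Z k \<omega> * W k \<omega> - 0\<bar>)
          \<le> \<P>(\<omega> in M k. \<epsilon> / K < \<bar>Z k \<omega> - 0\<bar>) + \<P>(\<omega> in M k. K < \<bar>W k \<omega>\<bar>)"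
      proof (rule prob_le_add)
        fix \<omega> assume *: "\<epsilon> < \<bar>Z k \<omega> * W k \<omega> - 0\<bar>"
        show "\<epsilon> / K < \<bar>Z k \<omega> - 0\<bar> \<or> K < \<bar>W k \<omega>\<bar>"
        proof (rule ccontr)
          assume "\<not> ?thesis"
          then have "\<bar>Z k \<omega>\<bar> * \<bar>W k \<omega>\<bar> \<le> \<epsilon> / K * K"
            using \<epsilon> K by (intro mult_mono) auto
          then show False using * K by (simp add: abs_mult)
        qed
      qed measurable
      with elim show ?case by linarith
    qed
    then show "\<exists>no. \<forall>k\<ge>no. norm (\<P>(\<omega> in M k. \<epsilon> < \<bar>Z k \<omega> * W k \<omega> - 0\<bar>) - 0) < r"
      by (simp add: eventually_sequentially)
  qed
qed

lemma bounded_in_prob_of_conv: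
  assumes [measurable]: "\<And>k. Z k \<in> borel_measurable (M k)"
    and Z: "conv_in_prob M Z c"
  shows "bounded_in_prob M Z"
  unfolding bounded_in_prob_def
proof safe
  fix \<epsilon> :: real assume \<epsilon>: "0 < \<epsilon>"
  have "eventually (\<lambda>k. \<P>(\<omega> in M k. 1 < \<bar>Z k \<omega> - c\<bar>) < \<epsilon>) sequentially"
    using Z \<epsilon> unfolding conv_in_prob_def by (intro order_tendstoD(2)) auto
  then have "eventually (\<lambda>k. \<P>(\<omega> in M k. \<bar>c\<bar> + 1 < \<bar>Z k \<omega>\<bar>) < \<epsilon>) sequentially"
  proof eventually_elim
    case (elim k)
    have "\<P>(\<omega> in M k. \<bar>c\<bar> + 1 < \<bar>Z k \<omega>\<bar>) \<le> \<P>(\<omega> in M k. 1 < \<bar>Z k \<omega> - c\<bar>)"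
      by (intro finite_measure_mono) auto
    with elim show ?case by linarith
  qed
  then show "\<exists>K>0. eventually (\<lambda>k. \<P>(\<omega> in M k. K < \<bar>Z k \<omega>\<bar>) < \<epsilon>) sequentially"
    by (intro exI[of _ "\<bar>c\<bar> + 1"]) auto
qed

lemma conv_in_prob_const: "a \<longlonglongrightarrow> c \<Longrightarrow> conv_in_prob M (\<lambda>k \<omega>. a k) c"
  unfolding conv_in_prob_def
proof safe
  fix \<epsilon> :: real assume "a \<longlonglongrightarrow> c" "0 < \<epsilon>"
  then have "eventually (\<lambda>k. dist (a k) c < \<epsilon>) sequentially" by (rule tendstoD)
  then have "eventually (\<lambda>k. \<P>(\<omega> in M k. \<epsilon> < \<bar>a k - c\<bar>) = 0) sequentially"
    by eventually_elim (auto simp: dist_real_def)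
  then show "(\<lambda>k. \<P>(\<omega> in M k. \<epsilon> < \<bar>a k - c\<bar>)) \<longlonglongrightarrow> 0"
    by (rule tendsto_eventually)
qed

lemma bounded_in_prob_second_moment:
  assumes [measurable]: "\<And>k. Z k \<in> borel_measurable (M k)"
    and int: "\<And>k. integrable (M k) (\<lambda>\<omega>. (Z k \<omega>)\<^sup>2)"
    and le: "\<And>k. (LINT \<omega>|M k. (Z k \<omega>)\<^sup>2) \<le> C"
  shows "bounded_in_prob M Z"
  unfolding bounded_in_prob_def
proof safe
  fix \<epsilon> :: real assume \<epsilon>: "0 < \<epsilon>"
  define K where "K = sqrt ((\<bar>C\<bar> + 1) / \<epsilon>)"
  have K: "0 < K" "K\<^sup>2 = (\<bar>C\<bar> + 1) / \<epsilon>" using \<epsilon> by (auto simp: K_def)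
  have "\<P>(\<omega> in M k. K < \<bar>Z k \<omega>\<bar>) < \<epsilon>" for k
  proof -
    have "\<P>(\<omega> in M k. K < \<bar>Z k \<omega>\<bar>) \<le> \<P>(\<omega> in M k. K \<le> \<bar>Z k \<omega>\<bar>)"
      by (intro finite_measure_mono) auto
    also have "\<dots> \<le> (LINT \<omega>|M k. (Z k \<omega>)\<^sup>2) / K\<^sup>2"
      using K int by (intro second_moment_method) auto
    also have "\<dots> \<le> \<bar>C\<bar> / K\<^sup>2"
      using le[of k] by (intro divide_right_mono) auto
    also have "\<dots> < \<epsilon>" using K(1) \<epsilon> by (simp add: K(2) field_simps)
    finally show ?thesis .
  qed
  then show "\<exists>K>0. eventually (\<lambda>k. \<P>(\<omega> in M k. K < \<bar>Z k \<omega>\<bar>) < \<epsilon>) sequentially"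
    using K by auto
qed

lemma conv_in_prob_relative_error:
  assumes [measurable]: "\<And>k. B k \<in> borel_measurable (M k)"
    and B: "conv_in_prob M B b" and b: "b \<noteq> 0"
  shows "conv_in_prob M (\<lambda>k \<omega>. (b - B k \<omega>) / B k \<omega>) 0"
proof (rule conv_in_probI_union[OF assms(1) assms(1) B B])
  fix \<epsilon> :: real assume \<epsilon>: "0 < \<epsilon>"
  define \<delta> where "\<delta> = min (\<bar>b\<bar> / 2) (\<epsilon> * \<bar>b\<bar> / 2)"
  have \<delta>: "0 < \<delta>" using b \<epsilon> by (auto simp: \<delta>_def)
  have "\<bar>(b - B k \<omega>) / B k \<omega> - 0\<bar> \<le> \<epsilon>" if "\<bar>B k \<omega> - b\<bar> \<le> \<delta>" for k \<omega>
  proof -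
    have "\<bar>B k \<omega> - b\<bar> \<le> \<bar>b\<bar> / 2" "\<bar>B k \<omega> - b\<bar> \<le> \<epsilon> * \<bar>b\<bar> / 2"
      using that by (auto simp: \<delta>_def)
    then have "\<bar>b\<bar> / 2 \<le> \<bar>B k \<omega>\<bar>" by linarith
    then have "\<epsilon> * (\<bar>b\<bar> / 2) \<le> \<epsilon> * \<bar>B k \<omega>\<bar>" using \<epsilon> by (intro mult_left_mono) auto
    then have "\<bar>b - B k \<omega>\<bar> \<le> \<epsilon> * \<bar>B k \<omega>\<bar>" using \<open>\<bar>B k \<omega> - b\<bar> \<le> \<epsilon> * \<bar>b\<bar> / 2\<close> by linarith
    moreover have "0 < \<bar>B k \<omega>\<bar>" using \<open>\<bar>b\<bar> / 2 \<le> \<bar>B k \<omega>\<bar>\<close> b by linarith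
    ultimately show ?thesis by (simp add: abs_divide divide_le_eq)
  qed
  with \<delta> show "\<exists>\<delta>>0. \<exists>\<eta>>0. \<forall>k. \<forall>\<omega>\<in>space (M k).
      \<bar>B k \<omega> - b\<bar> \<le> \<delta> \<longrightarrow> \<bar>B k \<omega> - b\<bar> \<le> \<eta> \<longrightarrow> \<bar>(b - B k \<omega>) / B k \<omega> - 0\<bar> \<le> \<epsilon>"
    by blast
qed

lemma bounded_in_prob_le_add:
  assumes [measurable]: "\<And>k. Z k \<in> borel_measurable (M k)" "\<And>k. W k \<in> borel_measurable (M k)"
    and Z: "bounded_in_prob M Z" and W: "bounded_in_prob M W"
    and le: "\<And>k \<omega>. \<omega> \<in> space (M k) \<Longrightarrow> \<bar>U k \<omega>\<bar> \<le> \<bar>Z k \<omega>\<bar> + \<bar>W k \<omega>\<bar>"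
  shows "bounded_in_prob M U"
  unfolding bounded_in_prob_def
proof safe
  fix \<epsilon> :: real assume "0 < \<epsilon>"
  then have "0 < \<epsilon> / 2" by simp
  then obtain K L where pos: "0 < K" "0 < L"
    and bd: "eventually (\<lambda>k. \<P>(\<omega> in M k. K < \<bar>Z k \<omega>\<bar>) < \<epsilon> / 2) sequentially"
      "eventually (\<lambda>k. \<P>(\<omega> in M k. L < \<bar>W k \<omega>\<bar>) < \<epsilon> / 2) sequentially"
    using Z W unfolding bounded_in_prob_def by meson
  from bd have "eventually (\<lambda>k. \<P>(\<omega> in M k. K + L < \<bar>U k \<omega>\<bar>) < \<epsilon>) sequentially"
  proof eventually_elim
    case (elim k)
    have "\<P>(\<omega> in M k. K + L < \<bar>U k \<omega>\<bar>) \<le> \<P>(\<omega> in M k. K < \<bar>Z k \<omega>\<bar>) + \<P>(\<omega> in M k. L < \<bar>W k \<omega>\<bar>)"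
    proof (rule prob_le_add)
      fix \<omega> assume "\<omega> \<in> space (M k)" "K + L < \<bar>U k \<omega>\<bar>"
      then show "K < \<bar>Z k \<omega>\<bar> \<or> L < \<bar>W k \<omega>\<bar>"
        using le[of \<omega> k] by linarith
    qed measurable
    with elim show ?case by linarith
  qed
  then show "\<exists>K>0. eventually (\<lambda>k. \<P>(\<omega> in M k. K < \<bar>U k \<omega>\<bar>) < \<epsilon>) sequentially"
    using pos by (intro exI[of _ "K + L"]) auto
qed

text \<open>
  On the event \<open>B = 0\<close> the quotient is Isabelle's \<open>0\<close> and the expansion fails, but the probability
  of that event tends to \<open>0\<close>.
\<close>

lemma ratio_expansion:
  fixes A B :: "nat \<Rightarrow> 'b \<Rightarrow> real" and m :: "nat \<Rightarrow> nat" and a b :: real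
  assumes [measurable]: "\<And>k. A k \<in> borel_measurable (M k)" "\<And>k. B k \<in> borel_measurable (M k)"
    and m: "filterlim m at_top sequentially" and b: "b \<noteq> 0"
    and L: "bounded_in_prob M (\<lambda>k \<omega>. (A k \<omega> / b - a * B k \<omega> / b\<^sup>2) / sqrt (m k))"
    and B: "bounded_in_prob M (\<lambda>k \<omega>. (B k \<omega> - m k * b) / sqrt (m k))"
  shows "conv_in_prob M
    (\<lambda>k \<omega>. sqrt (m k) * (A k \<omega> / B k \<omega> - a / b - (A k \<omega> / b - a * B k \<omega> / b\<^sup>2) / m k)) 0"
proof -
  have m_pos: "eventually (\<lambda>k. 0 < m k) sequentially"
    by (rule eventually_compose_filterlim[OF eventually_gt_at_top m])
  have "(\<lambda>k. 1 / sqrt (real (m k))) \<longlonglongrightarrow> 0"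
    by (intro tendsto_divide_0[OF tendsto_const] filterlim_at_top_imp_at_infinity
          filterlim_compose[OF sqrt_at_top] filterlim_compose[OF filterlim_real_sequentially] m)
  then have "conv_in_prob M (\<lambda>k \<omega>. 1 / sqrt (m k) * ((B k \<omega> - m k * b) / sqrt (m k))) 0"
    by (intro conv_in_prob_mult_bounded B conv_in_prob_const) auto
  also have "?this \<longleftrightarrow> conv_in_prob M (\<lambda>k \<omega>. B k \<omega> / m k - b) 0"
    by (intro conv_in_prob_cong eventually_mono[OF m_pos]) (auto simp: field_simps)
  finally have mean: "conv_in_prob M (\<lambda>k \<omega>. B k \<omega> / m k) b"
    by (simp add: conv_in_prob_shift[of _ _ b])
  have err: "conv_in_prob M (\<lambda>k \<omega>. (b - B k \<omega> / m k) / (B k \<omega> / m k)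
      * ((A k \<omega> / b - a * B k \<omega> / b\<^sup>2) / sqrt (m k))) 0" (is "conv_in_prob M ?E 0")
    by (intro conv_in_prob_mult_bounded conv_in_prob_relative_error mean L b) measurable
  have "conv_in_prob M (\<lambda>k \<omega>. if m k = 0 then 0 else
      sqrt (m k) * (A k \<omega> / B k \<omega> - a / b - (A k \<omega> / b - a * B k \<omega> / b\<^sup>2) / m k)) 0"
    (is "conv_in_prob M ?D 0")
  proof (rule conv_in_probI_union[OF _ _ mean err])
    fix \<epsilon> :: real assume \<epsilon>: "0 < \<epsilon>"
    have \<delta>: "0 < \<bar>b\<bar> / 2" using b by simp
    have D: "\<bar>?D k \<omega> - 0\<bar> \<le> \<epsilon>" if "\<bar>B k \<omega> / m k - b\<bar> \<le> \<bar>b\<bar> / 2" "\<bar>?E k \<omega> - 0\<bar> \<le> \<epsilon>" for k \<omega>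
    proof (cases "m k = 0")
      case False
      have "B k \<omega> \<noteq> 0" using that(1) b by auto
      have "?D k \<omega> = ?E k \<omega>"
      proof -
        define s where "s = sqrt (m k)"
        have s: "s \<noteq> 0" "real (m k) = s\<^sup>2" using False by (auto simp: s_def)
        show ?thesis using False \<open>B k \<omega> \<noteq> 0\<close> b s(1)
          unfolding s_def[symmetric] s(2) by (simp add: field_simps power2_eq_square)
      qed
      with that(2) show ?thesis by simp
    qed (use \<epsilon> in simp)
    show "\<exists>\<delta>>0. \<exists>\<eta>>0. \<forall>k. \<forall>\<omega>\<in>space (M k).
        \<bar>B k \<omega> / m k - b\<bar> \<le> \<delta> \<longrightarrow> \<bar>?E k \<omega> - 0\<bar> \<le> \<eta> \<longrightarrow> \<bar>?D k \<omega> - 0\<bar> \<le> \<epsilon>"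
    proof (rule exI[of _ "\<bar>b\<bar> / 2"], rule conjI[OF \<delta>], rule exI[of _ \<epsilon>], rule conjI[OF \<epsilon>],
        intro allI ballI impI)
    qed (rule D)
  qed measurable
  also have "conv_in_prob M ?D 0 \<longleftrightarrow> ?thesis"
    by (intro conv_in_prob_cong eventually_mono[OF m_pos]) auto
  finally show ?thesis .
qed

lemma char_diff_tendsto_0:
  assumes [measurable]: "\<And>k. Z k \<in> borel_measurable (M k)" "\<And>k. W k \<in> borel_measurable (M k)"
    and conv: "conv_in_prob M (\<lambda>k \<omega>. Z k \<omega> - W k \<omega>) 0"
  shows "(\<lambda>k. char (distr (M k) borel (Z k)) t - char (distr (M k) borel (W k)) t) \<longlonglongrightarrow> 0"
proof (rule LIMSEQ_I)
  fix r :: real assume r: "0 < r"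
  define \<epsilon> where "\<epsilon> = r / (2 * (\<bar>t\<bar> + 1))"
  have \<epsilon>: "0 < \<epsilon>" "\<bar>t\<bar> * \<epsilon> < r / 2" using r by (auto simp: \<epsilon>_def field_simps)
  have "eventually (\<lambda>k. \<P>(\<omega> in M k. \<epsilon> < \<bar>Z k \<omega> - W k \<omega> - 0\<bar>) < r / 4) sequentially"
    using conv \<epsilon>(1) r unfolding conv_in_prob_def by (intro order_tendstoD(2)[where y = 0]) auto
  then have "eventually (\<lambda>k. norm (char (distr (M k) borel (Z k)) t
      - char (distr (M k) borel (W k)) t - 0) < r) sequentially"
  proof eventually_elim
    case (elim k)
    let ?S = "{\<omega> \<in> space (M k). \<epsilon> < \<bar>Z k \<omega> - W k \<omega>\<bar>}"
    have iexp_bound: "norm (iexp (t * Z k \<omega>) - iexp (t * W k \<omega>)) \<le> \<bar>t\<bar> * \<epsilon> + 2 * indicator ?S \<omega>"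
      if "\<omega> \<in> space (M k)" for \<omega>
    proof (cases "\<omega> \<in> ?S")
      case True
      have "norm (iexp (t * Z k \<omega>) - iexp (t * W k \<omega>)) \<le> 1 + 1"
        by (rule norm_triangle_le_diff) simp
      then show ?thesis using True \<epsilon> by (simp add: add_increasing)
    next
      case False
      have "iexp (t * Z k \<omega>) - iexp (t * W k \<omega>)
          = iexp (t * W k \<omega>) * (iexp (t * (Z k \<omega> - W k \<omega>)) - 1)"
        by (simp add: algebra_simps flip: exp_add)
      then have "norm (iexp (t * Z k \<omega>) - iexp (t * W k \<omega>))
          = norm (iexp (t * (Z k \<omega> - W k \<omega>)) - 1)"
        by (simp add: norm_mult)
      also have "\<dots> \<le> \<bar>t * (Z k \<omega> - W k \<omega>)\<bar>"
        using iexp_approx1[of "t * (Z k \<omega> - W k \<omega>)" 0] by simp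
      also have "\<dots> \<le> \<bar>t\<bar> * \<epsilon>"
        using False that by (auto simp: abs_mult intro!: mult_left_mono)
      finally show ?thesis by (simp only: indicator_simps(2)[OF False])
    qed
    have int: "integrable (M k) (\<lambda>\<omega>. iexp (t * Z k \<omega>))" "integrable (M k) (\<lambda>\<omega>. iexp (t * W k \<omega>))"
      by (auto intro!: integrable_iexp)
    have "char (distr (M k) borel (Z k)) t - char (distr (M k) borel (W k)) t
        = (CLINT \<omega>|M k. iexp (t * Z k \<omega>) - iexp (t * W k \<omega>))"
      using int by (simp add: char_def integral_distr)
    also have "norm \<dots> \<le> (LINT \<omega>|M k. norm (iexp (t * Z k \<omega>) - iexp (t * W k \<omega>)))"
      by (rule integral_norm_bound)
    also have "\<dots> \<le> (LINT \<omega>|M k. \<bar>t\<bar> * \<epsilon> + 2 * indicator ?S \<omega>)"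
      using int iexp_bound
      by (intro integral_mono integrable_norm Bochner_Integration.integrable_diff
            Bochner_Integration.integrable_add integrable_mult_right integrable_real_indicator)
        (auto simp: emeasure_eq_measure)
    also have "\<dots> = \<bar>t\<bar> * \<epsilon> + 2 * prob k ?S"
      by (simp add: prob_space emeasure_eq_measure)
    also have "\<dots> < r" using elim \<epsilon>(2) by simp
    finally show ?case by simp
  qed
  then show "\<exists>no. \<forall>k\<ge>no. norm (char (distr (M k) borel (Z k)) t
      - char (distr (M k) borel (W k)) t - 0) < r"
    by (simp add: eventually_sequentially)
qed

end

subsection \<open>Independent and identically distributed samples\<close>

lemma (in prob_space) indep_var_independent_rvs:
  assumes "independent_rvs M A V B W"
    and F: "F \<in> A \<rightarrow>\<^sub>M borel" and G: "G \<in> B \<rightarrow>\<^sub>M borel"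
  shows "indep_var borel (\<lambda>\<omega>. F (V \<omega>)) borel (\<lambda>\<omega>. G (W \<omega>))"
proof -
  have V[measurable]: "V \<in> M \<rightarrow>\<^sub>M A" and W[measurable]: "W \<in> M \<rightarrow>\<^sub>M B"
    and ind: "indep_set {V -` a \<inter> space M | a. a \<in> sets A} {W -` b \<inter> space M | b. b \<in> sets B}"
    using assms(1) by (auto simp: independent_rvs_def)
  have vimage: "\<exists>b. (\<lambda>\<omega>. H (U \<omega>)) -` a \<inter> space M = U -` b \<inter> space M \<and> b \<in> sets N"
    if "U \<in> M \<rightarrow>\<^sub>M N" "H \<in> N \<rightarrow>\<^sub>M borel" "a \<in> sets borel" for U N a and H :: "_ \<Rightarrow> 'z::topological_space"
    using that by (intro exI[of _ "H -` a \<inter> space N"]) (auto dest: measurable_space intro: measurable_sets)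
  show ?thesis
    unfolding indep_var_def indep_vars_def2
  proof (intro conjI ballI)
    show "indep_sets (\<lambda>i. {case_bool (\<lambda>\<omega>. F (V \<omega>)) (\<lambda>\<omega>. G (W \<omega>)) i -` a \<inter> space M |a.
        a \<in> sets (case_bool borel borel i)}) UNIV"
    proof (rule indep_sets_mono_sets[OF ind[unfolded indep_set_def]])
      fix i :: bool
      show "{case_bool (\<lambda>\<omega>. F (V \<omega>)) (\<lambda>\<omega>. G (W \<omega>)) i -` a \<inter> space M |a. a \<in> sets (case_bool borel borel i)}
          \<subseteq> case_bool {V -` a \<inter> space M | a. a \<in> sets A} {W -` b \<inter> space M | b. b \<in> sets B} i"
        using vimage[OF V F] vimage[OF W G] by (cases i) force+
    qed
  qed (use F G in \<open>auto split: bool.split\<close>)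
qed

lemma real_distribution_normal_law: "real_distribution (normal_law m v)"
proof -
  interpret real_distribution std_normal_distribution by (rule real_dist_normal_dist)
  show ?thesis unfolding normal_law_def by (intro real_distribution_distr) simp
qed

lemma char_normal_law:
  assumes "0 \<le> v"
  shows "char (normal_law 0 v) t = exp (- (t\<^sup>2 * v) / 2)"
proof -
  have "char (normal_law 0 v) t = char std_normal_distribution (t * sqrt v)"
    by (simp add: char_def normal_law_def integral_distr mult.assoc)
  then show ?thesis
    using assms by (simp add: char_std_normal_distribution power_mult_distrib)
qed

lemma (in real_distribution) char_scaled_power_tendsto:
  assumes sq: "integrable M (\<lambda>x. x\<^sup>2)" and mean: "expectation (\<lambda>x. x) = 0"
    and V: "expectation (\<lambda>x. x\<^sup>2) = V"
  shows "(\<lambda>n. char M (t / sqrt (real n)) ^ n) \<longlonglongrightarrow> complex_of_real (exp (- (t\<^sup>2 * V) / 2))"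
proof -
  let ?s = "\<lambda>n. t / sqrt (real n)"
  let ?R = "\<lambda>n. expectation (\<lambda>x. min (6 * x\<^sup>2) (\<bar>?s n\<bar> * \<bar>x\<bar> ^ 3))"
  have int: "integrable M (\<lambda>x. x)"
    by (rule square_integrable_imp_integrable[OF _ sq]) simp
  have "0 \<le> V" unfolding V[symmetric] by simp
  have main: "eventually (\<lambda>n. norm (char M (?s n) ^ n - complex_of_real ((1 + (- (t\<^sup>2 * V) / 2) / n) ^ n))
      \<le> t\<^sup>2 / 6 * ?R n) sequentially"
  proof (rule eventually_sequentiallyI)
    fix n :: nat assume "n \<ge> nat \<lceil>t\<^sup>2 * V / 4\<rceil> + 1"
    then have n: "t\<^sup>2 * V / 4 \<le> n" "0 < n" by linarith+
    have sn: "(?s n)\<^sup>2 = t\<^sup>2 / n" using n by (simp add: power_divide)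
    have "norm (char M (?s n) - complex_of_real (1 - (?s n)\<^sup>2 * V / 2)) \<le> (?s n)\<^sup>2 / 6 * ?R n"
      using char_approx3[OF int mean sq, of V "?s n"] mean V by simp
    also have "1 - (?s n)\<^sup>2 * V / 2 = 1 + (- (t\<^sup>2 * V) / 2) / n"
      unfolding sn by simp
    finally have step: "norm (char M (?s n) - complex_of_real (1 + (- (t\<^sup>2 * V) / 2) / n)) \<le> t\<^sup>2 / n / 6 * ?R n"
      unfolding sn .
    have "\<bar>1 + (- (t\<^sup>2 * V) / 2) / n\<bar> \<le> 1"
      using n \<open>0 \<le> V\<close> by (intro abs_leI) (auto simp: field_simps)
    then have "norm (char M (?s n) ^ n - complex_of_real (1 + (- (t\<^sup>2 * V) / 2) / n) ^ n)
        \<le> n * norm (char M (?s n) - complex_of_real (1 + (- (t\<^sup>2 * V) / 2) / n))"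
      by (intro norm_power_diff cmod_char_le_1) (simp only: norm_of_real)
    also have "\<dots> \<le> n * (t\<^sup>2 / n / 6 * ?R n)"
      by (rule mult_left_mono[OF step]) simp
    also have "\<dots> = t\<^sup>2 / 6 * ?R n" using n by simp
    finally show "norm (char M (?s n) ^ n - complex_of_real ((1 + (- (t\<^sup>2 * V) / 2) / n) ^ n)) \<le> t\<^sup>2 / 6 * ?R n"
      by (simp only: of_real_power)
  qed
  have s0: "(\<lambda>n. \<bar>?s n\<bar>) \<longlonglongrightarrow> 0"
    by (intro tendsto_rabs_zero tendsto_divide_0[OF tendsto_const] filterlim_at_top_imp_at_infinity
          filterlim_compose[OF sqrt_at_top] filterlim_real_sequentially)
  have "?R \<longlonglongrightarrow> expectation (\<lambda>x. 0)"
  proof (rule integral_dominated_convergence[where w = "\<lambda>x. 6 * x\<^sup>2"])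
    show "AE x in M. (\<lambda>n. min (6 * x\<^sup>2) (\<bar>?s n\<bar> * \<bar>x\<bar> ^ 3)) \<longlonglongrightarrow> 0"
    proof (rule AE_I2)
      fix x :: real
      have "(\<lambda>n. min (6 * x\<^sup>2) (\<bar>?s n\<bar> * \<bar>x\<bar> ^ 3)) \<longlonglongrightarrow> min (6 * x\<^sup>2) (0 * \<bar>x\<bar> ^ 3)"
        by (intro tendsto_intros s0)
      then show "(\<lambda>n. min (6 * x\<^sup>2) (\<bar>?s n\<bar> * \<bar>x\<bar> ^ 3)) \<longlonglongrightarrow> 0" by simp
    qed
  qed (use sq in auto)
  then have R0: "(\<lambda>n. t\<^sup>2 / 6 * ?R n) \<longlonglongrightarrow> 0"
    using tendsto_mult_right_zero by auto
  have "(\<lambda>n. complex_of_real ((1 + (- (t\<^sup>2 * V) / 2) / n) ^ n)) \<longlonglongrightarrow> complex_of_real (exp (- (t\<^sup>2 * V) / 2))"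
    by (intro tendsto_of_real tendsto_exp_limit_sequentially)
  then show ?thesis
    by (rule Lim_transform) (rule Lim_null_comparison[OF main R0])
qed

lemma iid_copies_compose:
  assumes "prob_space M" and iid: "iid_copies M I Z P Z0" and Z0: "Z0 \<in> P \<rightarrow>\<^sub>M borel"
    and g: "g \<in> borel \<rightarrow>\<^sub>M borel"
  shows "iid_copies M I (\<lambda>i \<omega>. g (Z i \<omega>)) P (\<lambda>\<omega>. g (Z0 \<omega>))"
proof -
  interpret prob_space M by fact
  have ind: "indep_vars (\<lambda>_. borel) Z I" and eq: "\<And>i. i \<in> I \<Longrightarrow> distr M borel (Z i) = distr P borel Z0"
    using iid by (auto simp: iid_copies_def)
  have "distr M borel (\<lambda>\<omega>. g (Z i \<omega>)) = distr P borel (\<lambda>\<omega>. g (Z0 \<omega>))" if "i \<in> I" for i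
  proof -
    have "Z i \<in> M \<rightarrow>\<^sub>M borel" using ind that by (auto simp: indep_vars_def)
    then show ?thesis
      using eq[OF that] g Z0 distr_distr[of g borel borel "Z i" M] distr_distr[of g borel borel Z0 P]
      by (simp add: comp_def)
  qed
  with ind g show ?thesis
    unfolding iid_copies_def by (auto intro: indep_vars_compose2)
qed

lemma iid_sum_second_moment:
  fixes Z :: "nat \<Rightarrow> 'b \<Rightarrow> real"
  assumes M: "prob_space M" and P: "prob_space P" and I: "finite I"
    and iid: "iid_copies M I Z P Z0" and Z0[measurable]: "Z0 \<in> borel_measurable P"
    and sq: "integrable P (\<lambda>\<omega>. (Z0 \<omega>)\<^sup>2)" and mean: "(LINT \<omega>|P. Z0 \<omega>) = 0"
  shows "integrable M (\<lambda>\<omega>. (\<Sum>i\<in>I. Z i \<omega>)\<^sup>2)"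
    and "(LINT \<omega>|M. (\<Sum>i\<in>I. Z i \<omega>)\<^sup>2) = card I * (LINT \<omega>|P. (Z0 \<omega>)\<^sup>2)"
proof -
  interpret M: prob_space M by fact
  interpret P: prob_space P by fact
  have ind: "M.indep_vars (\<lambda>_. borel) Z I" and eq: "\<And>i. i \<in> I \<Longrightarrow> distr M borel (Z i) = distr P borel Z0"
    using iid by (auto simp: iid_copies_def)
  have meas[measurable]: "Z i \<in> borel_measurable M" if "i \<in> I" for i
    using ind that by (auto simp: M.indep_vars_def)
  have "integrable P Z0"
    by (rule P.square_integrable_imp_integrable[OF _ sq]) simp
  have transfer: "integrable M (\<lambda>\<omega>. h (Z i \<omega>)) \<longleftrightarrow> integrable P (\<lambda>\<omega>. h (Z0 \<omega>))"
      "(LINT \<omega>|M. h (Z i \<omega>)) = (LINT \<omega>|P. h (Z0 \<omega>))"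
    if "i \<in> I" "h \<in> borel_measurable borel" for i and h :: "real \<Rightarrow> real"
  proof -
    note [measurable] = that(2)
    have "integrable M (\<lambda>\<omega>. h (Z i \<omega>)) \<longleftrightarrow> integrable (distr M borel (Z i)) h"
      "(LINT \<omega>|M. h (Z i \<omega>)) = (LINT x|distr M borel (Z i). h x)"
      using that(1) by (simp_all add: integrable_distr_eq integral_distr)
    then show "integrable M (\<lambda>\<omega>. h (Z i \<omega>)) \<longleftrightarrow> integrable P (\<lambda>\<omega>. h (Z0 \<omega>))"
      "(LINT \<omega>|M. h (Z i \<omega>)) = (LINT \<omega>|P. h (Z0 \<omega>))"
      unfolding eq[OF that(1)] by (simp_all add: integrable_distr_eq integral_distr)
  qed
  have intZ: "integrable M (Z i)" "(LINT \<omega>|M. Z i \<omega>) = 0" if "i \<in> I" for i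
    using transfer[OF that, of "\<lambda>x. x"] \<open>integrable P Z0\<close> mean by auto
  have prod: "integrable M (\<lambda>\<omega>. Z i \<omega> * Z j \<omega>)
      \<and> (LINT \<omega>|M. Z i \<omega> * Z j \<omega>) = (if i = j then LINT \<omega>|P. (Z0 \<omega>)\<^sup>2 else 0)"
    if "i \<in> I" "j \<in> I" for i j
  proof (cases "i = j")
    case True
    then show ?thesis using transfer[OF that(1), of "\<lambda>x. x\<^sup>2"] sq by (simp add: power2_eq_square)
  next
    case False
    have *: "M.indep_vars (\<lambda>_. borel) Z {i, j}"
      by (rule M.indep_vars_subset[OF ind]) (use that in auto)
    have "integrable M (\<lambda>\<omega>. \<Prod>l\<in>{i, j}. Z l \<omega>)"
      "(LINT \<omega>|M. (\<Prod>l\<in>{i, j}. Z l \<omega>)) = (\<Prod>l\<in>{i, j}. LINT \<omega>|M. Z l \<omega>)"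
      using intZ that by (auto intro!: M.indep_vars_integrable[OF _ *] M.indep_vars_lebesgue_integral[OF _ *] simp del: prod.insert)
    then show ?thesis using False intZ that by simp
  qed
  have expand: "(\<Sum>i\<in>I. Z i \<omega>)\<^sup>2 = (\<Sum>i\<in>I. \<Sum>j\<in>I. Z i \<omega> * Z j \<omega>)" for \<omega>
    by (simp add: power2_eq_square sum_product)
  show "integrable M (\<lambda>\<omega>. (\<Sum>i\<in>I. Z i \<omega>)\<^sup>2)"
    unfolding expand using prod by (intro Bochner_Integration.integrable_sum) auto
  have "(LINT \<omega>|M. (\<Sum>i\<in>I. Z i \<omega>)\<^sup>2) = (\<Sum>i\<in>I. \<Sum>j\<in>I. LINT \<omega>|M. Z i \<omega> * Z j \<omega>)"
    unfolding expand using prod by (subst Bochner_Integration.integral_sum, force)+ simp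
  also have "\<dots> = (\<Sum>i\<in>I. \<Sum>j\<in>I. if i = j then LINT \<omega>|P. (Z0 \<omega>)\<^sup>2 else 0)"
    using prod by (intro sum.cong refl) auto
  also have "\<dots> = card I * (LINT \<omega>|P. (Z0 \<omega>)\<^sup>2)" using I by simp
  finally show "(LINT \<omega>|M. (\<Sum>i\<in>I. Z i \<omega>)\<^sup>2) = card I * (LINT \<omega>|P. (Z0 \<omega>)\<^sup>2)" .
qed

context prob_space_sequence
begin

lemma bounded_in_prob_iid_sum:
  fixes Z :: "nat \<Rightarrow> nat \<Rightarrow> 'b \<Rightarrow> real"
  assumes P: "prob_space P" and I: "\<And>k. finite (I k)"
    and iid: "\<And>k. iid_copies (M k) (I k) (Z k) P Z0" and Z0: "Z0 \<in> borel_measurable P"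
    and sq: "integrable P (\<lambda>\<omega>. (Z0 \<omega>)\<^sup>2)" and mean: "(LINT \<omega>|P. Z0 \<omega>) = 0"
  shows "bounded_in_prob M (\<lambda>k \<omega>. (\<Sum>i\<in>I k. Z k i \<omega>) / sqrt (card (I k)))"
proof (rule bounded_in_prob_second_moment)
  note moment = iid_sum_second_moment[OF prob_space_M P I iid Z0 sq mean]
  fix k
  have "Z k i \<in> borel_measurable (M k)" if "i \<in> I k" for i
    using iid[of k] that by (auto simp: iid_copies_def indep_vars_def)
  then show "(\<lambda>\<omega>. (\<Sum>i\<in>I k. Z k i \<omega>) / sqrt (card (I k))) \<in> borel_measurable (M k)"
    by measurable
  show "integrable (M k) (\<lambda>\<omega>. ((\<Sum>i\<in>I k. Z k i \<omega>) / sqrt (card (I k)))\<^sup>2)"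
    using moment(1)[of k] by (simp add: power_divide)
  show "(LINT \<omega>|M k. ((\<Sum>i\<in>I k. Z k i \<omega>) / sqrt (card (I k)))\<^sup>2) \<le> (LINT \<omega>|P. (Z0 \<omega>)\<^sup>2)"
    using moment(2)[of k] by (cases "card (I k) = 0") (simp_all add: power_divide)
qed

lemma char_iid_sum_tendsto:
  fixes Z :: "nat \<Rightarrow> nat \<Rightarrow> 'b \<Rightarrow> real"
  assumes P: "prob_space P" and I: "filterlim (\<lambda>k. card (I k)) at_top sequentially"
    and iid: "\<And>k. iid_copies (M k) (I k) (Z k) P Z0" and Z0[measurable]: "Z0 \<in> borel_measurable P"
    and sq: "integrable P (\<lambda>\<omega>. (Z0 \<omega>)\<^sup>2)" and mean: "(LINT \<omega>|P. Z0 \<omega>) = 0"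
  shows "(\<lambda>k. char (distr (M k) borel (\<lambda>\<omega>. (\<Sum>i\<in>I k. Z k i \<omega>) / sqrt (card (I k)))) t)
    \<longlonglongrightarrow> complex_of_real (exp (- (t\<^sup>2 * (LINT \<omega>|P. (Z0 \<omega>)\<^sup>2)) / 2))"
proof -
  interpret P: prob_space P by fact
  interpret D: real_distribution "distr P borel Z0"
    by (rule P.real_distribution_distr) simp
  have char_eq: "char (distr (M k) borel (\<lambda>\<omega>. (\<Sum>i\<in>I k. Z k i \<omega>) / sqrt (card (I k)))) t
      = char (distr P borel Z0) (t / sqrt (card (I k))) ^ card (I k)" for k
  proof -
    let ?c = "sqrt (card (I k))"
    have ind: "indep_vars k (\<lambda>_. borel) (Z k) (I k)"
      and eq: "\<And>i. i \<in> I k \<Longrightarrow> distr (M k) borel (Z k i) = distr P borel Z0"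
      using iid[of k] by (auto simp: iid_copies_def)
    have "char (distr (M k) borel (\<lambda>\<omega>. (\<Sum>i\<in>I k. Z k i \<omega>) / ?c)) t
        = char (distr (M k) borel (\<lambda>\<omega>. \<Sum>i\<in>I k. Z k i \<omega> / ?c)) t"
      by (simp add: sum_divide_distrib)
    also have "\<dots> = (\<Prod>i\<in>I k. char (distr (M k) borel (\<lambda>\<omega>. Z k i \<omega> / ?c)) t)"
      by (rule char_distr_sum) (rule indep_vars_compose2[OF ind], simp)
    also have "\<dots> = (\<Prod>i\<in>I k. char (distr P borel Z0) (t / ?c))"
    proof (rule prod.cong[OF refl])
      fix i assume i: "i \<in> I k"
      then have [measurable]: "Z k i \<in> borel_measurable (M k)"
        using ind by (auto simp: indep_vars_def)
      show "char (distr (M k) borel (\<lambda>\<omega>. Z k i \<omega> / ?c)) t = char (distr P borel Z0) (t / ?c)"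
        unfolding eq[OF i, symmetric] by (simp add: char_def integral_distr)
    qed
    finally show ?thesis by simp
  qed
  have lim: "(\<lambda>n. char (distr P borel Z0) (t / sqrt (real n)) ^ n)
      \<longlonglongrightarrow> complex_of_real (exp (- (t\<^sup>2 * (LINT \<omega>|P. (Z0 \<omega>)\<^sup>2)) / 2))"
    using sq mean by (intro D.char_scaled_power_tendsto) (simp_all add: integrable_distr_eq integral_distr)
  show ?thesis
    unfolding char_eq by (rule filterlim_compose[OF lim I])
qed

end


subsection \<open>True positive rate estimators\<close>

lemma pooled_sum_le:
  fixes x y :: real and n N :: nat
  assumes "n = 0 \<Longrightarrow> x = 0" "N = 0 \<Longrightarrow> y = 0"
  shows "\<bar>(x + y) / sqrt (n + N)\<bar> \<le> \<bar>x / sqrt n\<bar> + \<bar>y / sqrt N\<bar>"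
proof -
  have "\<bar>x\<bar> / sqrt (n + N) \<le> \<bar>x\<bar> / sqrt n" "\<bar>y\<bar> / sqrt (n + N) \<le> \<bar>y\<bar> / sqrt N"
    using assms by (cases "n = 0"; cases "N = 0"; auto intro!: divide_left_mono)+
  then have "(\<bar>x\<bar> + \<bar>y\<bar>) / sqrt (n + N) \<le> \<bar>x\<bar> / sqrt n + \<bar>y\<bar> / sqrt N"
    unfolding add_divide_distrib by (rule add_mono)
  moreover have "\<bar>x + y\<bar> / sqrt (n + N) \<le> (\<bar>x\<bar> + \<bar>y\<bar>) / sqrt (n + N)"
    by (intro divide_right_mono abs_triangle_ineq) simp
  ultimately show ?thesis by (simp add: abs_divide)
qed

lemma tpr_influence_sum:
  "(\<Sum>i\<in>I. tpr_influence P \<alpha> R0 W0 (R i, W i))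
    = (\<Sum>i\<in>I. of_bool (\<alpha> < R i) * W i) / (LINT \<omega>|P. W0 \<omega>)
      - (LINT \<omega>|P. of_bool (\<alpha> < R0 \<omega>) * W0 \<omega>) * (\<Sum>i\<in>I. W i) / (LINT \<omega>|P. W0 \<omega>)\<^sup>2"
  unfolding tpr_influence_def prod.case by (simp only: sum_subtractf sum_divide_distrib sum_distrib_left)

lemma tpr_influence_measurable[measurable]:
  "tpr_influence P \<alpha> R0 W0 \<in> borel_measurable borel"
proof -
  have "tpr_influence P \<alpha> R0 W0 \<in> borel_measurable (borel \<Otimes>\<^sub>M borel)"
    unfolding tpr_influence_def by measurable
  then show ?thesis by (simp add: borel_prod)
qed

lemma (in prob_space) tpr_influence_moments:
  assumes [measurable]: "R0 \<in> borel_measurable M" "W0 \<in> borel_measurable M"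
    and sq: "integrable M (\<lambda>\<omega>. (W0 \<omega>)\<^sup>2)" and mean: "expectation W0 \<noteq> 0"
  shows "expectation (\<lambda>\<omega>. tpr_influence M \<alpha> R0 W0 (R0 \<omega>, W0 \<omega>)) = 0"
    and "integrable M (\<lambda>\<omega>. (tpr_influence M \<alpha> R0 W0 (R0 \<omega>, W0 \<omega>))\<^sup>2)"
proof -
  have W: "integrable M W0" by (rule square_integrable_imp_integrable[OF _ sq]) simp
  have IW: "integrable M (\<lambda>\<omega>. of_bool (\<alpha> < R0 \<omega>) * W0 \<omega>)"
    by (rule Bochner_Integration.integrable_bound[OF W]) auto
  show "expectation (\<lambda>\<omega>. tpr_influence M \<alpha> R0 W0 (R0 \<omega>, W0 \<omega>)) = 0"
    using W IW mean by (simp add: tpr_influence_def power2_eq_square)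
  define c where "c = 1 / \<bar>expectation W0\<bar>
    + \<bar>expectation (\<lambda>\<omega>. of_bool (\<alpha> < R0 \<omega>) * W0 \<omega>)\<bar> / (expectation W0)\<^sup>2"
  have bound: "\<bar>tpr_influence M \<alpha> R0 W0 (R0 \<omega>, W0 \<omega>)\<bar> \<le> c * \<bar>W0 \<omega>\<bar>" for \<omega>
  proof -
    have "\<bar>tpr_influence M \<alpha> R0 W0 (R0 \<omega>, W0 \<omega>)\<bar>
        \<le> \<bar>of_bool (\<alpha> < R0 \<omega>) * W0 \<omega> / expectation W0\<bar>
          + \<bar>expectation (\<lambda>\<omega>. of_bool (\<alpha> < R0 \<omega>) * W0 \<omega>) * W0 \<omega> / (expectation W0)\<^sup>2\<bar>"
      unfolding tpr_influence_def by (simp only: prod.case abs_triangle_ineq4)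
    also have "\<dots> \<le> \<bar>W0 \<omega>\<bar> / \<bar>expectation W0\<bar>
          + \<bar>expectation (\<lambda>\<omega>. of_bool (\<alpha> < R0 \<omega>) * W0 \<omega>)\<bar> * \<bar>W0 \<omega>\<bar> / (expectation W0)\<^sup>2"
      by (intro add_mono) (auto simp: abs_mult abs_divide)
    also have "\<dots> = c * \<bar>W0 \<omega>\<bar>" by (simp add: c_def distrib_right)
    finally show ?thesis .
  qed
  have "(tpr_influence M \<alpha> R0 W0 (R0 \<omega>, W0 \<omega>))\<^sup>2 \<le> c\<^sup>2 * (W0 \<omega>)\<^sup>2" for \<omega>
    using power_mono[OF bound, of \<omega> 2] by (simp add: power_mult_distrib)
  then have le: "AE \<omega> in M. norm ((tpr_influence M \<alpha> R0 W0 (R0 \<omega>, W0 \<omega>))\<^sup>2) \<le> norm (c\<^sup>2 * (W0 \<omega>)\<^sup>2)"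
    by simp
  have "(\<lambda>\<omega>. (R0 \<omega>, W0 \<omega>)) \<in> borel_measurable M"
    by (rule borel_measurable_Pair) fact+
  then have meas: "(\<lambda>\<omega>. (tpr_influence M \<alpha> R0 W0 (R0 \<omega>, W0 \<omega>))\<^sup>2) \<in> borel_measurable M"
    by (intro borel_measurable_power measurable_compose[OF _ tpr_influence_measurable])
  show "integrable M (\<lambda>\<omega>. (tpr_influence M \<alpha> R0 W0 (R0 \<omega>, W0 \<omega>))\<^sup>2)"
    by (rule Bochner_Integration.integrable_bound[OF integrable_mult_right[OF sq] meas le])
qed

context prob_space_sequence
begin

lemma bounded_in_prob_pooled:
  fixes h :: "nat \<Rightarrow> nat \<Rightarrow> 'b \<Rightarrow> real"
  assumes [measurable]: "\<And>k i. i \<in> {1..n k + N k} \<Longrightarrow> h k i \<in> borel_measurable (M k)"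
    and "bounded_in_prob M (\<lambda>k \<omega>. (\<Sum>i=1..n k. h k i \<omega>) / sqrt (n k))"
    and "bounded_in_prob M (\<lambda>k \<omega>. (\<Sum>i=n k + 1..n k + N k. h k i \<omega>) / sqrt (N k))"
  shows "bounded_in_prob M (\<lambda>k \<omega>. (\<Sum>i=1..n k + N k. h k i \<omega>) / sqrt (n k + N k))"
proof (rule bounded_in_prob_le_add[OF _ _ assms(2,3)])
  show "(\<lambda>\<omega>. (\<Sum>i=1..n k. h k i \<omega>) / sqrt (n k)) \<in> borel_measurable (M k)" for k
    by measurable
  show "(\<lambda>\<omega>. (\<Sum>i=n k + 1..n k + N k. h k i \<omega>) / sqrt (N k)) \<in> borel_measurable (M k)" for k
    by measurable
  show "\<bar>(\<Sum>i=1..n k + N k. h k i \<omega>) / sqrt (n k + N k)\<bar>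
      \<le> \<bar>(\<Sum>i=1..n k. h k i \<omega>) / sqrt (n k)\<bar> + \<bar>(\<Sum>i=n k + 1..n k + N k. h k i \<omega>) / sqrt (N k)\<bar>" for k \<omega>
    by (subst sum.ub_add_nat, simp, rule pooled_sum_le) simp_all
qed

lemma tpr_estimator_expansion:
  assumes [measurable]: "\<And>k i. i \<in> {1..m k} \<Longrightarrow> R k i \<in> borel_measurable (M k)"
      "\<And>k i. i \<in> {1..m k} \<Longrightarrow> W k i \<in> borel_measurable (M k)"
    and m: "filterlim m at_top sequentially" and mean: "(LINT \<omega>|P. W0 \<omega>) \<noteq> 0"
    and L: "bounded_in_prob M
      (\<lambda>k \<omega>. (\<Sum>i=1..m k. tpr_influence P \<alpha> R0 W0 (R k i \<omega>, W k i \<omega>)) / sqrt (m k))"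
    and B: "bounded_in_prob M (\<lambda>k \<omega>. (\<Sum>i=1..m k. W k i \<omega> - (LINT \<omega>|P. W0 \<omega>)) / sqrt (m k))"
  shows "conv_in_prob M (\<lambda>k \<omega>. sqrt (m k) * (tpr_estimator \<alpha> (\<lambda>i. R k i \<omega>) (\<lambda>i. W k i \<omega>) (m k)
    - (LINT \<omega>|P. of_bool (\<alpha> < R0 \<omega>) * W0 \<omega>) / (LINT \<omega>|P. W0 \<omega>)
    - (\<Sum>i=1..m k. tpr_influence P \<alpha> R0 W0 (R k i \<omega>, W k i \<omega>)) / m k)) 0"
  unfolding tpr_estimator_def tpr_influence_sum
proof (rule ratio_expansion[OF _ _ m mean L[unfolded tpr_influence_sum]])
  show "bounded_in_prob M (\<lambda>k \<omega>. ((\<Sum>i=1..m k. W k i \<omega>) - m k * (LINT \<omega>|P. W0 \<omega>)) / sqrt (m k))"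
    using B by (simp add: sum_subtractf)
qed measurable

lemma conv_in_prob_mult_const:
  assumes "\<And>k. Z k \<in> borel_measurable (M k)" "conv_in_prob M Z 0" "a \<longlonglongrightarrow> c"
  shows "conv_in_prob M (\<lambda>k \<omega>. a k * Z k \<omega>) 0"
  unfolding mult.commute[of "a _"]
  by (intro conv_in_prob_mult_bounded bounded_in_prob_of_conv[OF _ conv_in_prob_const[OF assms(3)]]
        assms(1,2)) (rule borel_measurable_const)+

lemma prediction_powered_expansion:
  fixes n N :: "nat \<Rightarrow> nat" and \<theta>\<^sub>0 \<eta> w lam :: real
    and \<theta> \<theta>f \<theta>a \<omega>h SY S1 S2 :: "nat \<Rightarrow> 'b \<Rightarrow> real"
  assumes [measurable]: "\<And>k. \<theta> k \<in> borel_measurable (M k)" "\<And>k. \<theta>f k \<in> borel_measurable (M k)"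
      "\<And>k. \<theta>a k \<in> borel_measurable (M k)" "\<And>k. \<omega>h k \<in> borel_measurable (M k)"
      "\<And>k. SY k \<in> borel_measurable (M k)" "\<And>k. S1 k \<in> borel_measurable (M k)"
      "\<And>k. S2 k \<in> borel_measurable (M k)"
    and n: "filterlim n at_top sequentially" and N: "filterlim N at_top sequentially"
    and lam: "0 \<le> lam" "(\<lambda>k. real (n k) / real (N k)) \<longlonglongrightarrow> lam"
    and w: "conv_in_prob M \<omega>h w"
    and \<theta>: "conv_in_prob M (\<lambda>k \<omega>. sqrt (n k) * (\<theta> k \<omega> - \<theta>\<^sub>0 - SY k \<omega> / n k)) 0" (is "conv_in_prob M ?D1 0")
    and \<theta>f: "conv_in_prob M (\<lambda>k \<omega>. sqrt (n k) * (\<theta>f k \<omega> - \<eta> - S1 k \<omega> / n k)) 0" (is "conv_in_prob M ?D2 0")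
    and \<theta>a: "conv_in_prob M (\<lambda>k \<omega>. sqrt (n k + N k) * (\<theta>a k \<omega> - \<eta> - (S1 k \<omega> + S2 k \<omega>) / (n k + N k))) 0"
      (is "conv_in_prob M ?D3 0")
    and S1: "bounded_in_prob M (\<lambda>k \<omega>. S1 k \<omega> / sqrt (n k))" (is "bounded_in_prob M ?U")
    and S2: "bounded_in_prob M (\<lambda>k \<omega>. S2 k \<omega> / sqrt (N k))" (is "bounded_in_prob M ?V")
  shows "conv_in_prob M (\<lambda>k \<omega>. sqrt (n k) * (\<theta> k \<omega> + \<omega>h k \<omega> * (\<theta>a k \<omega> - \<theta>f k \<omega>) - \<theta>\<^sub>0)
    - ((SY k \<omega> - w / (1 + lam) * S1 k \<omega>) / sqrt (n k) + w * sqrt lam / (1 + lam) * S2 k \<omega> / sqrt (N k))) 0"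
proof -
  define \<rho> where "\<rho> k = real (N k) / (real (n k) + real (N k))" for k
  define \<tau> where "\<tau> k = sqrt (n k) * sqrt (N k) / (real (n k) + real (N k))" for k
  define \<kappa> where "\<kappa> k = sqrt (n k) / sqrt (real (n k) + real (N k))" for k
  let ?G = "\<lambda>k \<omega>. \<tau> k * ?V k \<omega> - \<rho> k * ?U k \<omega>"
  have pos: "eventually (\<lambda>k. 0 < n k \<and> 0 < N k) sequentially"
    by (intro eventually_conj eventually_compose_filterlim[OF eventually_gt_at_top] n N)
  have \<rho>_eq: "eventually (\<lambda>k. 1 / (n k / N k + 1) = \<rho> k) sequentially"
    using pos by eventually_elim (simp add: \<rho>_def field_simps)
  have \<tau>_eq: "eventually (\<lambda>k. sqrt (n k / N k) / (n k / N k + 1) = \<tau> k) sequentially"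
    using pos
  proof eventually_elim
    case (elim k)
    define r s where "r = sqrt (n k)" and "s = sqrt (N k)"
    have "0 < r" "0 < s" "real (n k) = r\<^sup>2" "real (N k) = s\<^sup>2" using elim by (auto simp: r_def s_def)
    then show ?case by (simp add: \<tau>_def real_sqrt_divide field_simps power2_eq_square)
  qed
  have \<kappa>_eq: "eventually (\<lambda>k. sqrt ((n k / N k) / (n k / N k + 1)) = \<kappa> k) sequentially"
    using pos by eventually_elim (simp add: \<kappa>_def field_simps flip: real_sqrt_divide)
  have \<rho>: "\<rho> \<longlonglongrightarrow> 1 / (lam + 1)"
    using lam by (intro Lim_transform_eventually[OF _ \<rho>_eq] tendsto_intros) auto
  have \<tau>: "\<tau> \<longlonglongrightarrow> sqrt lam / (lam + 1)"
    using lam by (intro Lim_transform_eventually[OF _ \<tau>_eq] tendsto_intros) auto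
  have \<kappa>: "\<kappa> \<longlonglongrightarrow> sqrt (lam / (lam + 1))"
    using lam by (intro Lim_transform_eventually[OF _ \<kappa>_eq] tendsto_intros) auto
  have coeff_le: "\<bar>\<tau> k\<bar> \<le> 1" "\<bar>\<rho> k\<bar> \<le> 1" for k
  proof -
    have "sqrt (n k) * sqrt (N k) \<le> sqrt (real (n k) + real (N k)) * sqrt (real (n k) + real (N k))"
      by (intro mult_mono) auto
    then show "\<bar>\<tau> k\<bar> \<le> 1" by (simp add: \<tau>_def divide_le_eq)
    show "\<bar>\<rho> k\<bar> \<le> 1" by (simp add: \<rho>_def divide_le_eq)
  qed
  have G: "bounded_in_prob M ?G"
  proof (rule bounded_in_prob_le_add[OF _ _ S1 S2])
    fix k \<omega>
    have "\<bar>?G k \<omega>\<bar> \<le> \<bar>\<tau> k\<bar> * \<bar>?V k \<omega>\<bar> + \<bar>\<rho> k\<bar> * \<bar>?U k \<omega>\<bar>"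
      by (rule order_trans[OF abs_triangle_ineq4]) (simp add: abs_mult)
    also have "\<dots> \<le> 1 * \<bar>?V k \<omega>\<bar> + 1 * \<bar>?U k \<omega>\<bar>"
      by (intro add_mono mult_right_mono coeff_le) auto
    finally show "\<bar>?G k \<omega>\<bar> \<le> \<bar>?U k \<omega>\<bar> + \<bar>?V k \<omega>\<bar>" by simp
  qed measurable
  have E: "conv_in_prob M (\<lambda>k \<omega>. \<kappa> k * ?D3 k \<omega> + (- 1) * ?D2 k \<omega>) (0 + 0)" (is "conv_in_prob M ?E _")
    by (intro conv_in_prob_add conv_in_prob_mult_const[OF _ \<theta>a \<kappa>]
          conv_in_prob_mult_const[OF _ \<theta>f tendsto_const]) measurable
  have \<omega>E: "conv_in_prob M (\<lambda>k \<omega>. ?E k \<omega> * \<omega>h k \<omega>) 0"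
    using E by (intro conv_in_prob_mult_bounded bounded_in_prob_of_conv[OF _ w]) (simp, measurable)
  have \<omega>G: "conv_in_prob M (\<lambda>k \<omega>. (\<omega>h k \<omega> - w) * ?G k \<omega>) 0"
    using w by (intro conv_in_prob_mult_bounded G) (auto simp: conv_in_prob_shift[of _ _ w])
  have coeff: "(\<lambda>k. w * (\<tau> k - sqrt lam / (lam + 1))) \<longlonglongrightarrow> 0" "(\<lambda>k. w * (1 / (lam + 1) - \<rho> k)) \<longlonglongrightarrow> 0"
    using tendsto_mult[OF tendsto_const[of w] tendsto_diff[OF \<tau> tendsto_const[of "sqrt lam / (lam + 1)"]]]
      tendsto_mult[OF tendsto_const[of w] tendsto_diff[OF tendsto_const[of "1 / (lam + 1)"] \<rho>]] by simp_all
  have VU: "conv_in_prob M (\<lambda>k \<omega>. w * (\<tau> k - sqrt lam / (lam + 1)) * ?V k \<omega>) 0"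
    "conv_in_prob M (\<lambda>k \<omega>. w * (1 / (lam + 1) - \<rho> k) * ?U k \<omega>) 0"
    by (intro conv_in_prob_mult_bounded conv_in_prob_const coeff S1 S2; measurable)+
  have lin: "conv_in_prob M (\<lambda>k \<omega>. ?D1 k \<omega> + (?E k \<omega> * \<omega>h k \<omega> + ((\<omega>h k \<omega> - w) * ?G k \<omega>
      + (w * (\<tau> k - sqrt lam / (lam + 1)) * ?V k \<omega> + w * (1 / (lam + 1) - \<rho> k) * ?U k \<omega>)))) (0 + (0 + (0 + (0 + 0))))"
    by (intro conv_in_prob_add \<theta> \<omega>E \<omega>G VU) measurable
  have eq: "eventually (\<lambda>k. \<forall>\<omega>\<in>space (M k).
      ?D1 k \<omega> + (?E k \<omega> * \<omega>h k \<omega> + ((\<omega>h k \<omega> - w) * ?G k \<omega>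
      + (w * (\<tau> k - sqrt lam / (lam + 1)) * ?V k \<omega> + w * (1 / (lam + 1) - \<rho> k) * ?U k \<omega>)))
      = sqrt (n k) * (\<theta> k \<omega> + \<omega>h k \<omega> * (\<theta>a k \<omega> - \<theta>f k \<omega>) - \<theta>\<^sub>0)
    - ((SY k \<omega> - w / (1 + lam) * S1 k \<omega>) / sqrt (n k) + w * sqrt lam / (1 + lam) * S2 k \<omega> / sqrt (N k))) sequentially"
    using pos
  proof (eventually_elim, intro ballI)
    fix k \<omega> assume k: "0 < n k \<and> 0 < N k"
    define r s q where "r = sqrt (n k)" and "s = sqrt (N k)" and "q = sqrt (n k + N k)"
    have rs: "0 < r" "0 < s" "0 < q" "real (n k) = r\<^sup>2" "real (N k) = s\<^sup>2" and q: "q\<^sup>2 = r\<^sup>2 + s\<^sup>2"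
      using k by (auto simp: r_def s_def q_def)
    have sqrts: "sqrt (r\<^sup>2) = r" "sqrt (s\<^sup>2) = s" "sqrt (r\<^sup>2 + s\<^sup>2) = q"
      using rs by (simp_all flip: q)
    have "?E k \<omega> + ?G k \<omega> = r * (\<theta>a k \<omega> - \<theta>f k \<omega>)"
    proof -
      have "\<kappa> k * ?D3 k \<omega> = r * (\<theta>a k \<omega> - \<eta> - (S1 k \<omega> + S2 k \<omega>) / (r\<^sup>2 + s\<^sup>2))"
        using rs(1,3) by (simp add: \<kappa>_def rs(4,5) sqrts)
      moreover have "?D2 k \<omega> = r * (\<theta>f k \<omega> - \<eta>) - S1 k \<omega> / r"
        using rs(1) by (simp add: rs(4) sqrts algebra_simps power2_eq_square)
      moreover have "?G k \<omega> = r * S2 k \<omega> / (r\<^sup>2 + s\<^sup>2) - s\<^sup>2 / (r\<^sup>2 + s\<^sup>2) * (S1 k \<omega> / r)"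
        using rs(1,2) by (simp add: \<tau>_def \<rho>_def rs(4,5) sqrts)
      moreover have "s\<^sup>2 / (r\<^sup>2 + s\<^sup>2) * (S1 k \<omega> / r) = S1 k \<omega> / r - r * S1 k \<omega> / (r\<^sup>2 + s\<^sup>2)"
      proof -
        have "r\<^sup>2 + s\<^sup>2 \<noteq> 0" using rs(1) by (simp add: add_pos_nonneg less_imp_neq[symmetric] sum_power2_eq_zero_iff)
        then show ?thesis using rs(1) by (simp add: divide_simps) (simp add: algebra_simps power2_eq_square)
      qed
      ultimately show ?thesis by (simp add: algebra_simps add_divide_distrib)
    qed
    moreover have "?D1 k \<omega> = r * (\<theta> k \<omega> - \<theta>\<^sub>0) - SY k \<omega> / r"
      using rs(1) by (simp add: rs(4) sqrts algebra_simps power2_eq_square)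
    moreover have "w * (\<tau> k - sqrt lam / (lam + 1)) * ?V k \<omega> + w * (1 / (lam + 1) - \<rho> k) * ?U k \<omega>
        = w * ?G k \<omega> + w / (1 + lam) * S1 k \<omega> / r - w * sqrt lam / (1 + lam) * S2 k \<omega> / s"
      by (simp add: r_def s_def algebra_simps)
    ultimately show "?D1 k \<omega> + (?E k \<omega> * \<omega>h k \<omega> + ((\<omega>h k \<omega> - w) * ?G k \<omega>
      + (w * (\<tau> k - sqrt lam / (lam + 1)) * ?V k \<omega> + w * (1 / (lam + 1) - \<rho> k) * ?U k \<omega>)))
      = sqrt (n k) * (\<theta> k \<omega> + \<omega>h k \<omega> * (\<theta>a k \<omega> - \<theta>f k \<omega>) - \<theta>\<^sub>0)
    - ((SY k \<omega> - w / (1 + lam) * S1 k \<omega>) / sqrt (n k) + w * sqrt lam / (1 + lam) * S2 k \<omega> / sqrt (N k))"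
    proof -
      assume EG: "?E k \<omega> + ?G k \<omega> = r * (\<theta>a k \<omega> - \<theta>f k \<omega>)"
        and D1: "?D1 k \<omega> = r * (\<theta> k \<omega> - \<theta>\<^sub>0) - SY k \<omega> / r"
        and VU: "w * (\<tau> k - sqrt lam / (lam + 1)) * ?V k \<omega> + w * (1 / (lam + 1) - \<rho> k) * ?U k \<omega>
          = w * ?G k \<omega> + w / (1 + lam) * S1 k \<omega> / r - w * sqrt lam / (1 + lam) * S2 k \<omega> / s"
      have *: "d + (e * o' + ((o' - w) * x + y)) = d + o' * (e + x) + (y - w * x)" for d e o' x y :: real
        by (simp add: algebra_simps)
      show ?thesis
        unfolding * unfolding D1 VU EG unfolding r_def[symmetric] s_def[symmetric] diff_divide_distrib
        by (simp add: ring_distribs)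
    qed
  qed
  show ?thesis
    using lin unfolding conv_in_prob_cong[OF eq] by (simp only: add_0_left)
qed

lemma char_two_sample_tendsto:
  fixes Z :: "nat \<Rightarrow> nat \<Rightarrow> 'b \<Rightarrow> 'o::second_countable_topology"
    and Z' :: "nat \<Rightarrow> nat \<Rightarrow> 'b \<Rightarrow> 'p::second_countable_topology"
    and g :: "'o \<Rightarrow> real" and h :: "'p \<Rightarrow> real"
  assumes P: "prob_space P"
    and I: "filterlim (\<lambda>k. card (I k)) at_top sequentially"
    and J: "filterlim (\<lambda>k. card (J k)) at_top sequentially"
    and iid: "\<And>k. iid_copies (M k) (I k) (Z k) P Z0" and Z0[measurable]: "Z0 \<in> P \<rightarrow>\<^sub>M borel"
    and iid': "\<And>k. iid_copies (M k) (J k) (Z' k) P Z0'" and Z0'[measurable]: "Z0' \<in> P \<rightarrow>\<^sub>M borel"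
    and indep: "\<And>k. independent_rvs (M k) (\<Pi>\<^sub>M i\<in>I k. borel) (\<lambda>\<omega>. \<lambda>i\<in>I k. Z k i \<omega>)
      (\<Pi>\<^sub>M i\<in>J k. borel) (\<lambda>\<omega>. \<lambda>i\<in>J k. Z' k i \<omega>)"
    and g[measurable]: "g \<in> borel_measurable borel" and h[measurable]: "h \<in> borel_measurable borel"
    and sq: "integrable P (\<lambda>\<omega>. (g (Z0 \<omega>))\<^sup>2)" "integrable P (\<lambda>\<omega>. (h (Z0' \<omega>))\<^sup>2)"
    and mean: "(LINT \<omega>|P. g (Z0 \<omega>)) = 0" "(LINT \<omega>|P. h (Z0' \<omega>)) = 0"
  shows "(\<lambda>k. char (distr (M k) borel (\<lambda>\<omega>. (\<Sum>i\<in>I k. g (Z k i \<omega>)) / sqrt (card (I k))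
      + (\<Sum>i\<in>J k. h (Z' k i \<omega>)) / sqrt (card (J k)))) t)
    \<longlonglongrightarrow> complex_of_real (exp (- (t\<^sup>2 * ((LINT \<omega>|P. (g (Z0 \<omega>))\<^sup>2) + (LINT \<omega>|P. (h (Z0' \<omega>))\<^sup>2))) / 2))"
proof -
  let ?A = "\<lambda>k \<omega>. (\<Sum>i\<in>I k. g (Z k i \<omega>)) / sqrt (card (I k))"
  let ?B = "\<lambda>k \<omega>. (\<Sum>i\<in>J k. h (Z' k i \<omega>)) / sqrt (card (J k))"
  have split: "char (distr (M k) borel (\<lambda>\<omega>. ?A k \<omega> + ?B k \<omega>)) t
      = char (distr (M k) borel (?A k)) t * char (distr (M k) borel (?B k)) t" for k
  proof (rule char_distr_add)
    have "indep_var k borel (\<lambda>\<omega>. (\<Sum>i\<in>I k. g ((\<lambda>i\<in>I k. Z k i \<omega>) i)) / sqrt (card (I k)))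
        borel (\<lambda>\<omega>. (\<Sum>i\<in>J k. h ((\<lambda>i\<in>J k. Z' k i \<omega>) i)) / sqrt (card (J k)))"
      by (rule indep_var_independent_rvs[OF indep,
            where F = "\<lambda>v. (\<Sum>i\<in>I k. g (v i)) / sqrt (card (I k))"
              and G = "\<lambda>v. (\<Sum>i\<in>J k. h (v i)) / sqrt (card (J k))"]) measurable
    then show "indep_var k borel (?A k) borel (?B k)" by (simp cong: sum.cong)
  qed
  have "(\<lambda>k. char (distr (M k) borel (?A k)) t * char (distr (M k) borel (?B k)) t)
      \<longlonglongrightarrow> complex_of_real (exp (- (t\<^sup>2 * (LINT \<omega>|P. (g (Z0 \<omega>))\<^sup>2)) / 2))
        * complex_of_real (exp (- (t\<^sup>2 * (LINT \<omega>|P. (h (Z0' \<omega>))\<^sup>2)) / 2))"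
    by (intro tendsto_mult char_iid_sum_tendsto[OF P I] char_iid_sum_tendsto[OF P J]
          iid_copies_compose[OF prob_space_M iid Z0 g] iid_copies_compose[OF prob_space_M iid' Z0' h] sq mean)
      measurable
  also have "complex_of_real (exp (- (t\<^sup>2 * (LINT \<omega>|P. (g (Z0 \<omega>))\<^sup>2)) / 2))
        * complex_of_real (exp (- (t\<^sup>2 * (LINT \<omega>|P. (h (Z0' \<omega>))\<^sup>2)) / 2))
      = complex_of_real (exp (- (t\<^sup>2 * ((LINT \<omega>|P. (g (Z0 \<omega>))\<^sup>2) + (LINT \<omega>|P. (h (Z0' \<omega>))\<^sup>2))) / 2))"
    by (simp only: of_real_mult[symmetric] exp_add[symmetric]) (simp add: field_simps)
  finally show ?thesis unfolding split .
qed

end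

lemma borel_measurable_fst_snd:
  "fst \<in> borel_measurable borel" "snd \<in> borel_measurable borel"
  by (intro borel_measurable_continuous_onI continuous_intros)+

lemma integrable_mult_of_squares:
  fixes u v :: "'a \<Rightarrow> real"
  assumes [measurable]: "u \<in> borel_measurable M" "v \<in> borel_measurable M"
    and "integrable M (\<lambda>x. (u x)\<^sup>2)" "integrable M (\<lambda>x. (v x)\<^sup>2)"
  shows "integrable M (\<lambda>x. u x * v x)"
proof (rule Bochner_Integration.integrable_bound)
  show "integrable M (\<lambda>x. (u x)\<^sup>2 + (v x)\<^sup>2)" using assms by simp
  have "\<bar>a * b\<bar> \<le> a\<^sup>2 + b\<^sup>2" for a b :: real
    using sum_squares_bound[of "\<bar>a\<bar>" "\<bar>b\<bar>"] mult_nonneg_nonneg[of "\<bar>a\<bar>" "\<bar>b\<bar>"]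
    unfolding abs_mult power2_abs by linarith
  then show "AE x in M. norm (u x * v x) \<le> norm ((u x)\<^sup>2 + (v x)\<^sup>2)" by simp
qed measurable

theorem corollary5p1p1:
  fixes P :: "'a measure" and S :: "'x measure"
    and X :: "'a \<Rightarrow> 'x" and Y :: "'a \<Rightarrow> real"
    and R f :: "'x \<Rightarrow> real" and \<alpha> :: real
    and M :: "nat \<Rightarrow> 'b measure" and n N :: "nat \<Rightarrow> nat"
    and Xs :: "nat \<Rightarrow> nat \<Rightarrow> 'b \<Rightarrow> 'x" and Ys :: "nat \<Rightarrow> nat \<Rightarrow> 'b \<Rightarrow> real"
  defines "\<phi>Y \<equiv> tpr_influence P \<alpha> (\<lambda>\<omega>. R (X \<omega>)) Y"
    and "\<phi>f \<equiv> tpr_influence P \<alpha> (\<lambda>\<omega>. R (X \<omega>)) (\<lambda>\<omega>. f (X \<omega>))"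
    and "\<theta>0 \<equiv> \<P>(\<omega> in P. \<alpha> < R (X \<omega>) \<bar> Y \<omega> = 1)"
    and "\<theta>hat \<equiv> \<lambda>k \<omega>. tpr_estimator \<alpha> (\<lambda>i. R (Xs k i \<omega>)) (\<lambda>i. Ys k i \<omega>) (n k)"
    and "\<theta>hat_f \<equiv> \<lambda>k \<omega>. tpr_estimator \<alpha> (\<lambda>i. R (Xs k i \<omega>)) (\<lambda>i. f (Xs k i \<omega>)) (n k)"
    and "\<theta>hat_f_all \<equiv> \<lambda>k \<omega>.
           tpr_estimator \<alpha> (\<lambda>i. R (Xs k i \<omega>)) (\<lambda>i. f (Xs k i \<omega>)) (n k + N k)"
  assumes P: "prob_space P"
    and X: "X \<in> P \<rightarrow>\<^sub>M S" and Y: "Y \<in> borel_measurable P"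
    and R: "R \<in> borel_measurable S" and f: "f \<in> borel_measurable S"
    and Y_binary: "AE \<omega> in P. Y \<omega> \<in> {0, 1}"
    and Y_prob: "0 < \<P>(\<omega> in P. Y \<omega> = 1)" "\<P>(\<omega> in P. Y \<omega> = 1) < 1"
    and f_nonneg: "AE \<omega> in P. 0 \<le> f (X \<omega>)"
    and f_mean: "(LINT \<omega>|P. f (X \<omega>)) * (1 - (LINT \<omega>|P. f (X \<omega>))) \<noteq> 0"
    and f_square: "integrable P (\<lambda>\<omega>. (f (X \<omega>))\<^sup>2)"
    and \<phi>f_pos: "0 < (LINT \<omega>|P. (\<phi>f (R (X \<omega>), f (X \<omega>)))\<^sup>2)"
    and M: "\<And>k. prob_space (M k)"
    and Xs: "\<And>k i. i \<in> {1..n k + N k} \<Longrightarrow> Xs k i \<in> M k \<rightarrow>\<^sub>M S"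
    and labeled: "\<And>k. iid_copies (M k) {1..n k}
           (\<lambda>i \<omega>. (R (Xs k i \<omega>), f (Xs k i \<omega>), Ys k i \<omega>))
           P (\<lambda>\<omega>. (R (X \<omega>), f (X \<omega>), Y \<omega>))"
    and unlabeled: "\<And>k. iid_copies (M k) {n k + 1..n k + N k}
           (\<lambda>i \<omega>. (R (Xs k i \<omega>), f (Xs k i \<omega>)))
           P (\<lambda>\<omega>. (R (X \<omega>), f (X \<omega>)))"
    and indep: "\<And>k. independent_rvs (M k)
           (\<Pi>\<^sub>M i\<in>{1..n k}. borel)
           (\<lambda>\<omega>. \<lambda>i\<in>{1..n k}. (R (Xs k i \<omega>), f (Xs k i \<omega>), Ys k i \<omega>))
           (\<Pi>\<^sub>M i\<in>{n k + 1..n k + N k}. borel)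
           (\<lambda>\<omega>. \<lambda>i\<in>{n k + 1..n k + N k}. (R (Xs k i \<omega>), f (Xs k i \<omega>)))"
    and n: "filterlim n at_top sequentially"
    and N: "filterlim N at_top sequentially"
  shows "\<theta>0 = (LINT \<omega>|P. of_bool (\<alpha> < R (X \<omega>)) * Y \<omega>) / (LINT \<omega>|P. Y \<omega>)
    \<and> asymptotically_linear M n (\<lambda>k i \<omega>. (R (Xs k i \<omega>), Ys k i \<omega>)) \<theta>hat \<theta>0 \<phi>Y
    \<and> asymptotically_linear M n (\<lambda>k i \<omega>. (R (Xs k i \<omega>), f (Xs k i \<omega>))) \<theta>hat_f
        ((LINT \<omega>|P. of_bool (\<alpha> < R (X \<omega>)) * f (X \<omega>)) / (LINT \<omega>|P. f (X \<omega>))) \<phi>f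
    \<and> (\<forall>lam \<omega>hat.
          0 \<le> lam \<and> (\<lambda>k. real (n k) / real (N k)) \<longlonglongrightarrow> lam
          \<and> (\<forall>k. \<omega>hat k \<in> borel_measurable (M k))
          \<and> conv_in_prob M \<omega>hat
              ((LINT \<omega>|P. \<phi>Y (R (X \<omega>), Y \<omega>) * \<phi>f (R (X \<omega>), f (X \<omega>)))
               / (LINT \<omega>|P. (\<phi>f (R (X \<omega>), f (X \<omega>)))\<^sup>2))
          \<longrightarrow> weak_conv_m
                (\<lambda>k. distr (M k) borel (\<lambda>\<omega>. sqrt (real (n k)) *
                   (\<theta>hat k \<omega> + \<omega>hat k \<omega> * (\<theta>hat_f_all k \<omega> - \<theta>hat_f k \<omega>) - \<theta>0)))
                (normal_law 0
                  ((LINT \<omega>|P. (\<phi>Y (R (X \<omega>), Y \<omega>))\<^sup>2)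
                   - (LINT \<omega>|P. \<phi>Y (R (X \<omega>), Y \<omega>) * \<phi>f (R (X \<omega>), f (X \<omega>)))\<^sup>2
                     / ((1 + lam) * (LINT \<omega>|P. (\<phi>f (R (X \<omega>), f (X \<omega>)))\<^sup>2)))))"
proof -
  interpret P: prob_space P by (rule P)
  interpret M: prob_space_sequence M by (rule prob_space_sequence.intro[OF M])
  note [measurable] = X Y R f Xs
  let ?R0 = "\<lambda>\<omega>. R (X \<omega>)" and ?f0 = "\<lambda>\<omega>. f (X \<omega>)"
  let ?\<eta> = "(LINT \<omega>|P. of_bool (\<alpha> < R (X \<omega>)) * f (X \<omega>)) / (LINT \<omega>|P. f (X \<omega>))"

  have meanY: "(LINT \<omega>|P. Y \<omega>) = \<P>(\<omega> in P. Y \<omega> = 1)"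
  proof -
    have "(LINT \<omega>|P. Y \<omega>) = (LINT \<omega>|P. indicator {\<omega> \<in> space P. Y \<omega> = 1} \<omega>)"
      using Y_binary by (intro integral_cong_AE) (auto split: split_indicator elim!: eventually_mono)
    then show ?thesis by simp
  qed
  have "(LINT \<omega>|P. of_bool (\<alpha> < R (X \<omega>)) * Y \<omega>)
      = (LINT \<omega>|P. indicator {\<omega> \<in> space P. \<alpha> < R (X \<omega>) \<and> Y \<omega> = 1} \<omega>)"
    using Y_binary AE_space
    by (intro integral_cong_AE) (auto split: split_indicator elim!: eventually_mono)
  then have \<theta>0: "\<theta>0 = (LINT \<omega>|P. of_bool (\<alpha> < R (X \<omega>)) * Y \<omega>) / (LINT \<omega>|P. Y \<omega>)"
    unfolding \<theta>0_def cond_prob_def meanY by simp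
  have "AE \<omega> in P. norm ((Y \<omega>)\<^sup>2) \<le> norm (1::real)"
    using Y_binary by eventually_elim auto
  then have Y_square: "integrable P (\<lambda>\<omega>. (Y \<omega>)\<^sup>2)"
    by (rule Bochner_Integration.integrable_bound[rotated 2]) auto
  have EY: "(LINT \<omega>|P. Y \<omega>) \<noteq> 0" using Y_prob by (simp add: meanY)
  have Ef: "(LINT \<omega>|P. f (X \<omega>)) \<noteq> 0" using f_mean by auto

  have R0[measurable]: "?R0 \<in> borel_measurable P" and f0[measurable]: "?f0 \<in> borel_measurable P"
    by measurable
  note \<phi>Y_moments = P.tpr_influence_moments[OF R0 Y Y_square EY, where \<alpha> = \<alpha>, folded \<phi>Y_def]
  note \<phi>f_moments = P.tpr_influence_moments[OF R0 f0 f_square Ef, where \<alpha> = \<alpha>, folded \<phi>f_def]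
  have \<phi>Y[measurable]: "\<phi>Y \<in> borel_measurable borel" and \<phi>f[measurable]: "\<phi>f \<in> borel_measurable borel"
    unfolding \<phi>Y_def \<phi>f_def by (rule tpr_influence_measurable)+
  have pairs[measurable]: "(\<lambda>\<omega>. (R (X \<omega>), Y \<omega>)) \<in> borel_measurable P"
    "(\<lambda>\<omega>. (R (X \<omega>), f (X \<omega>))) \<in> borel_measurable P"
    "(\<lambda>\<omega>. (R (X \<omega>), f (X \<omega>), Y \<omega>)) \<in> borel_measurable P"
    by (intro borel_measurable_Pair R0 f0 Y)+
  have \<phi>Y0[measurable]: "(\<lambda>\<omega>. \<phi>Y (R (X \<omega>), Y \<omega>)) \<in> borel_measurable P"
    and \<phi>f0[measurable]: "(\<lambda>\<omega>. \<phi>f (R (X \<omega>), f (X \<omega>))) \<in> borel_measurable P"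
    by (rule measurable_compose[OF pairs(1) \<phi>Y] measurable_compose[OF pairs(2) \<phi>f])+

  note [measurable] = borel_measurable_fst_snd
  have proj[measurable]: "(\<lambda>z :: real \<times> real \<times> real. \<phi>Y (fst z, snd (snd z))) \<in> borel_measurable borel"
    "(\<lambda>z :: real \<times> real \<times> real. \<phi>f (fst z, fst (snd z))) \<in> borel_measurable borel"
    by (rule measurable_compose[OF _ \<phi>Y] measurable_compose[OF _ \<phi>f], rule borel_measurable_Pair, measurable)+

  have Rs[measurable]: "(\<lambda>\<omega>. R (Xs k i \<omega>)) \<in> borel_measurable (M k)"
    and fs[measurable]: "(\<lambda>\<omega>. f (Xs k i \<omega>)) \<in> borel_measurable (M k)"
    if "i \<in> {1..n k + N k}" for k i
    using measurable_compose[OF Xs[OF that] R] measurable_compose[OF Xs[OF that] f] by auto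
  have Ys[measurable]: "Ys k i \<in> borel_measurable (M k)" if "i \<in> {1..n k}" for k i
  proof -
    have "(\<lambda>\<omega>. (R (Xs k i \<omega>), f (Xs k i \<omega>), Ys k i \<omega>)) \<in> borel_measurable (M k)"
      using labeled[of k] that by (auto simp: iid_copies_def M.indep_vars_def)
    then have "(\<lambda>\<omega>. snd (snd (R (Xs k i \<omega>), f (Xs k i \<omega>), Ys k i \<omega>))) \<in> borel_measurable (M k)"
      by measurable
    then show ?thesis by simp
  qed
  have \<phi>Ys[measurable]: "(\<lambda>\<omega>. \<phi>Y (R (Xs k i \<omega>), Ys k i \<omega>)) \<in> borel_measurable (M k)"
    if "i \<in> {1..n k}" for k i
    using that by (intro measurable_compose[OF _ \<phi>Y] borel_measurable_Pair Rs Ys) auto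
  have \<phi>fs[measurable]: "(\<lambda>\<omega>. \<phi>f (R (Xs k i \<omega>), f (Xs k i \<omega>))) \<in> borel_measurable (M k)"
    if "i \<in> {1..n k + N k}" for k i
    using that by (intro measurable_compose[OF _ \<phi>f] borel_measurable_Pair Rs fs)

  note lab = iid_copies_compose[OF M labeled pairs(3)]
  note unlab = iid_copies_compose[OF M unlabeled pairs(2)]
  have center: "integrable P (\<lambda>\<omega>. (W \<omega> - P.expectation W)\<^sup>2)" "(LINT \<omega>|P. W \<omega> - P.expectation W) = 0"
    if "integrable P (\<lambda>\<omega>. (W \<omega>)\<^sup>2)" "W \<in> borel_measurable P" for W :: "'a \<Rightarrow> real"
  proof -
    have "integrable P W" by (rule P.square_integrable_imp_integrable[OF that(2,1)])
    with that show "integrable P (\<lambda>\<omega>. (W \<omega> - P.expectation W)\<^sup>2)" "(LINT \<omega>|P. W \<omega> - P.expectation W) = 0"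
      by (simp_all add: power2_diff P.prob_space)
  qed
  have bddY: "bounded_in_prob M (\<lambda>k \<omega>. (\<Sum>i=1..n k. \<phi>Y (R (Xs k i \<omega>), Ys k i \<omega>)) / sqrt (n k))"
    using M.bounded_in_prob_iid_sum[OF P _ lab[OF proj(1)]] \<phi>Y_moments by simp
  have bddf: "bounded_in_prob M (\<lambda>k \<omega>. (\<Sum>i=1..n k. \<phi>f (R (Xs k i \<omega>), f (Xs k i \<omega>))) / sqrt (n k))"
    using M.bounded_in_prob_iid_sum[OF P _ lab[OF proj(2)]] \<phi>f_moments by simp
  have bddf': "bounded_in_prob M
      (\<lambda>k \<omega>. (\<Sum>i=n k + 1..n k + N k. \<phi>f (R (Xs k i \<omega>), f (Xs k i \<omega>))) / sqrt (N k))"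
    using M.bounded_in_prob_iid_sum[OF P _ unlab[OF \<phi>f]] \<phi>f_moments by simp
  have bddYc: "bounded_in_prob M (\<lambda>k \<omega>. (\<Sum>i=1..n k. Ys k i \<omega> - (LINT \<omega>|P. Y \<omega>)) / sqrt (n k))"
    using M.bounded_in_prob_iid_sum[OF P _ lab[where g = "\<lambda>z. snd (snd z) - (LINT \<omega>|P. Y \<omega>)"]]
      center[OF Y_square Y] by simp
  have bddfc: "bounded_in_prob M (\<lambda>k \<omega>. (\<Sum>i=1..n k. f (Xs k i \<omega>) - (LINT \<omega>|P. f (X \<omega>))) / sqrt (n k))"
    using M.bounded_in_prob_iid_sum[OF P _ lab[where g = "\<lambda>z. fst (snd z) - (LINT \<omega>|P. f (X \<omega>))"]]
      center[OF f_square f0] by simp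
  have bddfc': "bounded_in_prob M
      (\<lambda>k \<omega>. (\<Sum>i=n k + 1..n k + N k. f (Xs k i \<omega>) - (LINT \<omega>|P. f (X \<omega>))) / sqrt (N k))"
    using M.bounded_in_prob_iid_sum[OF P _ unlab[where g = "\<lambda>z. snd z - (LINT \<omega>|P. f (X \<omega>))"]]
      center[OF f_square f0] by simp
  have nN: "filterlim (\<lambda>k. n k + N k) at_top sequentially"
    by (rule filterlim_at_top_mono[OF n]) auto

  have expY: "conv_in_prob M (\<lambda>k \<omega>. sqrt (n k) * (\<theta>hat k \<omega> - \<theta>0
      - (\<Sum>i=1..n k. \<phi>Y (R (Xs k i \<omega>), Ys k i \<omega>)) / n k)) 0"
    unfolding \<theta>0 \<theta>hat_def \<phi>Y_def
    by (intro M.tpr_estimator_expansion n EY bddYc bddY[unfolded \<phi>Y_def] Rs Ys) auto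
  have expf: "conv_in_prob M (\<lambda>k \<omega>. sqrt (n k) * (\<theta>hat_f k \<omega> - ?\<eta>
      - (\<Sum>i=1..n k. \<phi>f (R (Xs k i \<omega>), f (Xs k i \<omega>))) / n k)) 0"
    unfolding \<theta>hat_f_def \<phi>f_def
    by (intro M.tpr_estimator_expansion n Ef bddfc bddf[unfolded \<phi>f_def] Rs fs) auto
  have expf_all: "conv_in_prob M (\<lambda>k \<omega>. sqrt (n k + N k) * (\<theta>hat_f_all k \<omega> - ?\<eta>
      - (\<Sum>i=1..n k + N k. \<phi>f (R (Xs k i \<omega>), f (Xs k i \<omega>))) / (n k + N k))) 0"
    unfolding \<theta>hat_f_all_def \<phi>f_def of_nat_add[symmetric]
    by (intro M.tpr_estimator_expansion nN Ef M.bounded_in_prob_pooled bddfc bddfc'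
          bddf[unfolded \<phi>f_def] bddf'[unfolded \<phi>f_def] Rs fs) (auto intro: \<phi>fs[unfolded \<phi>f_def])

  have estimators[measurable]: "\<theta>hat k \<in> borel_measurable (M k)" "\<theta>hat_f k \<in> borel_measurable (M k)"
    "\<theta>hat_f_all k \<in> borel_measurable (M k)" for k
    unfolding \<theta>hat_def \<theta>hat_f_def \<theta>hat_f_all_def tpr_estimator_def by measurable

  have linY: "asymptotically_linear M n (\<lambda>k i \<omega>. (R (Xs k i \<omega>), Ys k i \<omega>)) \<theta>hat \<theta>0 \<phi>Y"
    using expY by (simp add: asymptotically_linear_def small_o_prob_def mult.commute)
  have linf: "asymptotically_linear M n (\<lambda>k i \<omega>. (R (Xs k i \<omega>), f (Xs k i \<omega>))) \<theta>hat_f ?\<eta> \<phi>f"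
    using expf by (simp add: asymptotically_linear_def small_o_prob_def mult.commute)

  define VY where "VY = (LINT \<omega>|P. (\<phi>Y (R (X \<omega>), Y \<omega>))\<^sup>2)"
  define Vf where "Vf = (LINT \<omega>|P. (\<phi>f (R (X \<omega>), f (X \<omega>)))\<^sup>2)"
  define C where "C = (LINT \<omega>|P. \<phi>Y (R (X \<omega>), Y \<omega>) * \<phi>f (R (X \<omega>), f (X \<omega>)))"
  have "0 < Vf" using \<phi>f_pos by (simp add: Vf_def)
  have int: "integrable P (\<lambda>\<omega>. \<phi>Y (R (X \<omega>), Y \<omega>))" "integrable P (\<lambda>\<omega>. \<phi>f (R (X \<omega>), f (X \<omega>)))"
    "integrable P (\<lambda>\<omega>. \<phi>Y (R (X \<omega>), Y \<omega>) * \<phi>f (R (X \<omega>), f (X \<omega>)))"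
    by (rule P.square_integrable_imp_integrable[OF \<phi>Y0 \<phi>Y_moments(2)]
          P.square_integrable_imp_integrable[OF \<phi>f0 \<phi>f_moments(2)]
          integrable_mult_of_squares[OF \<phi>Y0 \<phi>f0 \<phi>Y_moments(2) \<phi>f_moments(2)])+

  have "weak_conv_m (\<lambda>k. distr (M k) borel (\<lambda>\<omega>. sqrt (real (n k)) *
          (\<theta>hat k \<omega> + \<omega>hat k \<omega> * (\<theta>hat_f_all k \<omega> - \<theta>hat_f k \<omega>) - \<theta>0)))
        (normal_law 0 (VY - C\<^sup>2 / ((1 + lam) * Vf)))"
    if lam: "0 \<le> lam" "(\<lambda>k. real (n k) / real (N k)) \<longlonglongrightarrow> lam"
      and \<omega>hat[measurable]: "\<And>k. \<omega>hat k \<in> borel_measurable (M k)" and w: "conv_in_prob M \<omega>hat (C / Vf)"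
    for lam and \<omega>hat :: "nat \<Rightarrow> 'b \<Rightarrow> real"
  proof -
    define c where "c = C / Vf / (1 + lam)"
    define d where "d = C / Vf * sqrt lam / (1 + lam)"
    define g where "g z = \<phi>Y (fst z, snd (snd z)) - c * \<phi>f (fst z, fst (snd z))" for z :: "real \<times> real \<times> real"
    define h where "h p = d * \<phi>f p" for p
    have [measurable]: "g \<in> borel_measurable borel" "h \<in> borel_measurable borel"
      unfolding g_def h_def by measurable
    have g0: "g (R (X \<omega>), f (X \<omega>), Y \<omega>) = \<phi>Y (R (X \<omega>), Y \<omega>) - c * \<phi>f (R (X \<omega>), f (X \<omega>))" for \<omega>
      by (simp add: g_def)
    have g_mean: "(LINT \<omega>|P. g (R (X \<omega>), f (X \<omega>), Y \<omega>)) = 0"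
      unfolding g0 using int \<phi>Y_moments(1) \<phi>f_moments(1) by simp
    have h_mean: "(LINT \<omega>|P. h (R (X \<omega>), f (X \<omega>))) = 0"
      unfolding h_def using \<phi>f_moments(1) by simp
    have g_expand: "(g (R (X \<omega>), f (X \<omega>), Y \<omega>))\<^sup>2 = (\<phi>Y (R (X \<omega>), Y \<omega>))\<^sup>2
        - 2 * c * (\<phi>Y (R (X \<omega>), Y \<omega>) * \<phi>f (R (X \<omega>), f (X \<omega>))) + c\<^sup>2 * (\<phi>f (R (X \<omega>), f (X \<omega>)))\<^sup>2" for \<omega>
      unfolding g0 by (simp add: power2_diff power_mult_distrib)
    have g_sq: "integrable P (\<lambda>\<omega>. (g (R (X \<omega>), f (X \<omega>), Y \<omega>))\<^sup>2)"
      unfolding g_expand using int(3) \<phi>Y_moments(2) \<phi>f_moments(2) by simp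
    have h_sq: "integrable P (\<lambda>\<omega>. (h (R (X \<omega>), f (X \<omega>)))\<^sup>2)"
      unfolding h_def power_mult_distrib using \<phi>f_moments(2) by simp
    have Vg: "(LINT \<omega>|P. (g (R (X \<omega>), f (X \<omega>), Y \<omega>))\<^sup>2) = VY - 2 * c * C + c\<^sup>2 * Vf"
      unfolding g_expand VY_def C_def Vf_def using int(3) \<phi>Y_moments(2) \<phi>f_moments(2) by simp
    have Vh: "(LINT \<omega>|P. (h (R (X \<omega>), f (X \<omega>)))\<^sup>2) = d\<^sup>2 * Vf"
      unfolding h_def power_mult_distrib Vf_def by simp
    have variance: "(LINT \<omega>|P. (g (R (X \<omega>), f (X \<omega>), Y \<omega>))\<^sup>2) + (LINT \<omega>|P. (h (R (X \<omega>), f (X \<omega>)))\<^sup>2)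
        = VY - C\<^sup>2 / ((1 + lam) * Vf)"
    proof -
      have "d\<^sup>2 = c\<^sup>2 * lam" using lam(1) by (simp add: c_def d_def power_mult_distrib power_divide)
      then have "c\<^sup>2 * Vf + d\<^sup>2 * Vf = c\<^sup>2 * (1 + lam) * Vf" by (simp add: algebra_simps)
      also have "\<dots> = c * C" using \<open>0 < Vf\<close> lam(1) by (simp add: c_def power2_eq_square)
      also have "c * C = C\<^sup>2 / ((1 + lam) * Vf)" by (simp add: c_def power2_eq_square mult.commute)
      finally show ?thesis unfolding Vg Vh by (simp add: c_def power2_eq_square mult.commute)
    qed
    have variance_nonneg: "0 \<le> VY - C\<^sup>2 / ((1 + lam) * Vf)"
      unfolding variance[symmetric] by simp
    let ?T = "\<lambda>k \<omega>. sqrt (real (n k)) *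
          (\<theta>hat k \<omega> + \<omega>hat k \<omega> * (\<theta>hat_f_all k \<omega> - \<theta>hat_f k \<omega>) - \<theta>0)"
    let ?L = "\<lambda>k \<omega>. (\<Sum>i=1..n k. g (R (Xs k i \<omega>), f (Xs k i \<omega>), Ys k i \<omega>)) / sqrt (n k)
        + (\<Sum>i=n k + 1..n k + N k. h (R (Xs k i \<omega>), f (Xs k i \<omega>))) / sqrt (N k)"
    have L_eq: "?L k \<omega> = ((\<Sum>i=1..n k. \<phi>Y (R (Xs k i \<omega>), Ys k i \<omega>))
          - C / Vf / (1 + lam) * (\<Sum>i=1..n k. \<phi>f (R (Xs k i \<omega>), f (Xs k i \<omega>)))) / sqrt (n k)
        + C / Vf * sqrt lam / (1 + lam) * (\<Sum>i=n k + 1..n k + N k. \<phi>f (R (Xs k i \<omega>), f (Xs k i \<omega>))) / sqrt (N k)" for k \<omega>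
      unfolding g_def h_def fst_conv snd_conv sum_subtractf sum_distrib_left[symmetric] c_def d_def by (rule refl)
    have L[measurable]: "?L k \<in> borel_measurable (M k)" for k
      unfolding L_eq by measurable
    have "conv_in_prob M (\<lambda>k \<omega>. ?T k \<omega> - ?L k \<omega>) 0"
      unfolding L_eq
    proof (rule M.prediction_powered_expansion[OF _ _ _ _ _ _ _ n N lam w expY expf _ bddf bddf'])
      show "conv_in_prob M (\<lambda>k \<omega>. sqrt (n k + N k) * (\<theta>hat_f_all k \<omega> - ?\<eta>
          - ((\<Sum>i=1..n k. \<phi>f (R (Xs k i \<omega>), f (Xs k i \<omega>)))
            + (\<Sum>i=n k + 1..n k + N k. \<phi>f (R (Xs k i \<omega>), f (Xs k i \<omega>)))) / (n k + N k))) 0"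
        using expf_all by (subst sum.ub_add_nat[symmetric]) auto
    qed measurable
    then have remainder: "(\<lambda>k. char (distr (M k) borel (?T k)) t - char (distr (M k) borel (?L k)) t) \<longlonglongrightarrow> 0" for t
      by (intro M.char_diff_tendsto_0) measurable
    have "(\<lambda>k. char (distr (M k) borel (?L k)) t)
        \<longlonglongrightarrow> complex_of_real (exp (- (t\<^sup>2 * (VY - C\<^sup>2 / ((1 + lam) * Vf))) / 2))" for t
      using M.char_two_sample_tendsto[OF P _ _ labeled pairs(3) unlabeled pairs(2) indep _ _ g_sq h_sq g_mean h_mean]
        n N unfolding variance by simp
    then have "(\<lambda>k. char (distr (M k) borel (?T k)) t)
        \<longlonglongrightarrow> char (normal_law 0 (VY - C\<^sup>2 / ((1 + lam) * Vf))) t" for t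
      unfolding char_normal_law[OF variance_nonneg] by (rule Lim_transform[OF _ remainder])
    then show ?thesis
      by (intro levy_continuity real_distribution_normal_law M.real_distribution_distr) measurable
  qed
  then show ?thesis
    using \<theta>0 linY linf unfolding VY_def Vf_def C_def by blast
qed

end
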